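(* (1) Let $k\ge 0$ and $i\in\{0,1,2,3\}$ be integers with $4k+i\ge1$. Then $I(C_{2,4k+i})$ has the same simple homotopy type as $$\begin{cases} \bigvee_3 \Diamond^{2k-1} & (i=0),\\ \Diamond^{2k-1} & (i=1),\\ \Diamond^{2k} & (i=2),\\ \Diamond^{2k+1} & (i=3).\end{cases}$$ (2) Let $k\ge 0$ and $i\in\{0,1,\dots,7\}$ be integers with $8k+i\ge1$. Then $I(C_{3,8k+i})$ has the same simple homotopy type as $$\begin{cases} \bigvee_5 \Diamond^{6k-1} & (i=0),\\ \Diamond^{6k-1} & (i=1),\\ \Diamond^{6k+1} & (i=2,3),\\ \bigvee_3\Diamond^{6k+2} & (i=4),\\ \Diamond^{6k+3} & (i=5,6),\\ \Diamond^{6k+5} & (i=7).\end{cases}$$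
   Context: Graphs are finite and undirected; loops and multiple edges are allowed. The planar square grid graph $P_{m,n}$ has vertex set $\{1,\dots,m\}\times\{1,\dots,n\}$, with $(i_1,j_1)$ and $(i_2,j_2)$ adjacent if and only if they differ by exactly $1$ in one coordinate and agree in the other. For $m,n\ge1$, $C_{m,n}$ is the graph obtained from $P_{m,n+1}$ by identifying the vertices $(i,1)$ and $(i,n+1)$ for $i=1,\dots,m$ and the corresponding edges (edge $(i,1)(i+1,1)$ with edge $(i,n+1)(i+1,n+1)$); for $n=1$ every vertex carries a loop. An independent set of a graph is a set of vertices no two of which are joined by an edge (a vertex carrying a loop belongs to no independent set). The independence complex $I(G)$ is the simplicial complex whose simplices are the independent sets of $G$ (including the empty set $\emptyset$). $\Diamond^n$ is the join of $n+1$ copies of $\partial\Delta^1$ (two points), a triangulation of the $n$-sphere; $\Diamond^{-1}=\{\emptyset\}$. $\bigvee_r K$ is the wedge sum of $r$ copies of $K$, obtained from their disjoint union by identifying one vertex from each copy to a single vertex. An elementary collapse of a simplicial complex removes a pair of simplices $\sigma\subsetneq\tau$, with $\sigma$ nonempty, $\dim\tau=\dim\sigma+1$, and $\tau$ the only simplex properly containing $\sigma$; an elementary expansion is the inverse operation. Two finite simplicial complexes have the same simple homotopy type if they are connected, up to simplicial isomorphism, by a finite sequence of elementary collapses and elementary expansions. *)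

theory Defs
  imports Main
begin

section \<open>Finite multigraphs with loops\<close>

text \<open>The set of ends of an edge has two elements, or one element if the edge is a loop.\<close>

record ('v, 'e) multigraph =
  verts :: "'v set"
  edges :: "'e set"
  ends :: "'e \<Rightarrow> 'v set"

definition grid_adj :: "nat \<times> nat \<Rightarrow> nat \<times> nat \<Rightarrow> bool" where
  "grid_adj u v \<longleftrightarrow>
     (fst u = fst v \<and> (snd u = snd v + 1 \<or> snd v = snd u + 1)) \<or>
     (snd u = snd v \<and> (fst u = fst v + 1 \<or> fst v = fst u + 1))"

definition grid_graph :: "nat \<Rightarrow> nat \<Rightarrow> (nat \<times> nat, (nat \<times> nat) set) multigraph" where
  "grid_graph m n =
     \<lparr>verts = {1..m} \<times> {1..n},
      edges = {{u, v} | u v. u \<in> {1..m} \<times> {1..n} \<and> v \<in> {1..m} \<times> {1..n} \<and> grid_adj u v},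
      ends = (\<lambda>e. e)\<rparr>"

text \<open>The cylindrical grid is the quotient of \<open>grid_graph m (n + 1)\<close> that glues column \<open>n + 1\<close>,
  with its edges, to column \<open>1\<close>. The quotient is formed on representatives: \<open>wrap\<close> and
  \<open>wrap_edge\<close> move column \<open>n + 1\<close> to column \<open>1\<close>. An edge not contained in column \<open>n + 1\<close> is kept
  as it is and only its ends are moved, so for \<open>n = 1\<close> there is a loop at every vertex, and for
  \<open>n = 2\<close> the two edges between \<open>(i, 1)\<close> and \<open>(i, 2)\<close> stay distinct.\<close>

definition wrap :: "nat \<Rightarrow> nat \<times> nat \<Rightarrow> nat \<times> nat" where
  "wrap n v = (fst v, if snd v = n + 1 then 1 else snd v)"

definition wrap_edge :: "nat \<Rightarrow> (nat \<times> nat) set \<Rightarrow> (nat \<times> nat) set" where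
  "wrap_edge n e = (if \<forall>v\<in>e. snd v = n + 1 then wrap n ` e else e)"

definition cyl_graph :: "nat \<Rightarrow> nat \<Rightarrow> (nat \<times> nat, (nat \<times> nat) set) multigraph" where
  "cyl_graph m n =
     \<lparr>verts = wrap n ` verts (grid_graph m (n + 1)),
      edges = wrap_edge n ` edges (grid_graph m (n + 1)),
      ends = (\<lambda>e. wrap n ` e)\<rparr>"

section \<open>Finite abstract simplicial complexes\<close>

text \<open>A complex is identified with its set of simplices, which always contains the empty simplex.
  Its vertex set is the union of its simplices.\<close>

definition finite_complex :: "'a set set \<Rightarrow> bool" where
  "finite_complex K \<longleftrightarrow>
     finite K \<and> (\<forall>\<sigma>\<in>K. finite \<sigma>) \<and> {} \<in> K \<and> (\<forall>\<sigma>\<in>K. \<forall>\<rho>. \<rho> \<subseteq> \<sigma> \<longrightarrow> \<rho> \<in> K)"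

text \<open>The case \<open>u = v\<close> excludes the vertices that carry a loop.\<close>

definition indep_set :: "('v, 'e) multigraph \<Rightarrow> 'v set \<Rightarrow> bool" where
  "indep_set G S \<longleftrightarrow>
     S \<subseteq> verts G \<and> (\<forall>u\<in>S. \<forall>v\<in>S. \<not> (\<exists>e\<in>edges G. ends G e = {u, v}))"

definition indep_complex :: "('v, 'e) multigraph \<Rightarrow> 'v set set" where
  "indep_complex G = {S. indep_set G S}"

definition simplicial_iso :: "'a set set \<Rightarrow> 'b set set \<Rightarrow> bool" where
  "simplicial_iso K L \<longleftrightarrow>
     (\<exists>f. bij_betw f (\<Union>K) (\<Union>L) \<and> (\<forall>\<sigma>. \<sigma> \<subseteq> \<Union>K \<longrightarrow> (\<sigma> \<in> K \<longleftrightarrow> f ` \<sigma> \<in> L)))"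

definition join_power :: "nat \<Rightarrow> 'a set set \<Rightarrow> (nat \<times> 'a) set set" where
  "join_power r K = {(\<Union>c<r. Pair c ` s c) | s. \<forall>c<r. s c \<in> K}"

definition simplex_boundary :: "nat \<Rightarrow> nat set set" where
  "simplex_boundary n = {\<sigma>. \<sigma> \<subset> {0..n}}"

text \<open>The dimension is an integer \<open>n \<ge> - 1\<close>; the value at \<open>- 1\<close> is \<open>{{}}\<close>.\<close>

definition diamond :: "int \<Rightarrow> (nat \<times> nat) set set" where
  "diamond n = join_power (nat (n + 1)) (simplex_boundary 1)"

text \<open>\<open>wedge r b K\<close> is the wedge sum of \<open>r \<ge> 1\<close> copies of \<open>K\<close>, where \<open>b c\<close> is the vertex of \<open>K\<close>
  at which the copy with number \<open>c\<close> is attached: all vertices \<open>(c, b c)\<close> of the disjoint union are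
  identified with \<open>(0, b 0)\<close>.\<close>

definition disjoint_copies :: "nat \<Rightarrow> 'a set set \<Rightarrow> (nat \<times> 'a) set set" where
  "disjoint_copies r K = {Pair c ` \<sigma> | c \<sigma>. c < r \<and> \<sigma> \<in> K}"

definition wedge :: "nat \<Rightarrow> (nat \<Rightarrow> 'a) \<Rightarrow> 'a set set \<Rightarrow> (nat \<times> 'a) set set" where
  "wedge r b K = (\<lambda>\<sigma>. (\<lambda>(c, v). if v = b c then (0, b 0) else (c, v)) ` \<sigma>) ` disjoint_copies r K"

section \<open>Simple homotopy type\<close>

text \<open>\<open>dim \<tau> = dim \<sigma> + 1\<close> is expressed by cardinalities, as \<open>dim \<sigma> = card \<sigma> - 1\<close>.\<close>

definition elementary_collapse :: "'a set set \<Rightarrow> 'a set set \<Rightarrow> bool" where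
  "elementary_collapse K L \<longleftrightarrow>
     finite_complex K \<and>
     (\<exists>\<sigma> \<tau>. \<sigma> \<in> K \<and> \<tau> \<in> K \<and> \<sigma> \<noteq> {} \<and> \<sigma> \<subset> \<tau> \<and> card \<tau> = card \<sigma> + 1 \<and>
        (\<forall>\<rho>\<in>K. \<sigma> \<subset> \<rho> \<longrightarrow> \<rho> = \<tau>) \<and> L = K - {\<sigma>, \<tau>})"

text \<open>The given complexes may have different vertex types. The intermediate complexes are taken
  with vertices in \<open>nat\<close>, which is no restriction, as every finite complex is isomorphic to such
  a complex.\<close>

definition simple_homotopy_step :: "nat set set \<Rightarrow> nat set set \<Rightarrow> bool" where
  "simple_homotopy_step K L \<longleftrightarrow>
     elementary_collapse K L \<or> elementary_collapse L K \<or> simplicial_iso K L"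

definition same_simple_homotopy_type :: "'a set set \<Rightarrow> 'b set set \<Rightarrow> bool" where
  "same_simple_homotopy_type K L \<longleftrightarrow>
     finite_complex K \<and> finite_complex L \<and>
     (\<exists>K' L'. finite_complex K' \<and> finite_complex L' \<and>
        simplicial_iso K K' \<and> simple_homotopy_step\<^sup>*\<^sup>* K' L' \<and> simplicial_iso L' L)"

end

theory Submission
  imports Defs
begin

text \<open>If the link of a simplex \<open>\<sigma>\<close> is a cone, or collapses to a cone by the same procedure, then all
  simplices containing \<open>\<sigma>\<close> can be collapsed away. In an independence complex this deletes a vertex
  \<open>v\<close> of the graph (\<open>\<sigma> = {v}\<close>) or adds an edge \<open>uv\<close> (\<open>\<sigma> = {u, v}\<close>); the expansions insert
  vertices and remove edges. In a window of \<open>p + 2\<close> consecutive columns of the cylinder, with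
  \<open>p = 4\<close> for two rows and \<open>p = 8\<close> for three rows, such moves join the first column to the last one
  and then cut off the \<open>p\<close> columns between them, which reduce to 2, respectively 6, isolated edges.
  Each isolated edge suspends the independence complex, and this gives the periodicity. The
  finitely many remaining cylinders reduce to a complete graph with isolated edges, that is, to an
  iterated suspension of finitely many points. If there are \<open>r + 1\<close> points, then this is compared with
  the wedge of \<open>r\<close> spheres through the complex in which the equators of all spheres have been blown
  up into a single one: it collapses to both.\<close>

section \<open>Simple homotopy type as an equivalence relation\<close>

text \<open>Suspension is never treated as an operation: isolated edges stay in the graph as row
  \<open>0\<close>, so each comparison is made for all \<open>s\<close> at once and no invariance
  under suspension has to be proved. A move must be justified locally, because one window serves
  cylinders of every length. Hence an apex must be a vertex all of whose neighbours are known.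
  Unknown neighbours of other vertices are harmless: they only shrink the stars that are collapsed.
  A link need not be a cone at once, so a certificate may first collapse the stars of some vertices
  inside it. Shortening keeps columns \<open>1\<close> and \<open>p + 2\<close> apart, so the
  shorter cylinder has at least two columns. The base cases therefore have \<open>2\<close> to
  \<open>p + 1\<close> columns, residues 0 and 1 are reached with one shortening less, and a single
  column, with its loops, is treated directly. If a reduction ends with \<open>t\<close> isolated
  edges, then no further point means a sphere of dimension \<open>t - 1\<close>, and
  \<open>r + 1\<close> points mean \<open>r\<close> spheres of dimension \<open>t\<close>.\<close>

lemma finite_complex_finite_Union: "finite_complex K \<Longrightarrow> finite (\<Union>K)"
  unfolding finite_complex_def by blast

lemma simplicial_isoI:
  assumes "bij_betw f (\<Union>K) (\<Union>L)" "\<And>\<sigma>. \<sigma> \<subseteq> \<Union>K \<Longrightarrow> \<sigma> \<in> K \<longleftrightarrow> f ` \<sigma> \<in> L"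
  shows "simplicial_iso K L"
  using assms unfolding simplicial_iso_def by (intro exI[of _ f]) simp

lemma simplicial_isoE:
  assumes "simplicial_iso K L"
  obtains f where "bij_betw f (\<Union>K) (\<Union>L)"
    "\<forall>\<sigma>. \<sigma> \<subseteq> \<Union>K \<longrightarrow> (\<sigma> \<in> K \<longleftrightarrow> f ` \<sigma> \<in> L)"
proof -
  obtain f where "bij_betw f (\<Union>K) (\<Union>L) \<and> (\<forall>\<sigma>. \<sigma> \<subseteq> \<Union>K \<longrightarrow> (\<sigma> \<in> K \<longleftrightarrow> f ` \<sigma> \<in> L))"
    using assms unfolding simplicial_iso_def by (rule exE)
  then show ?thesis using that[of f] by simp
qed

lemma simplicial_iso_sym:
  assumes "simplicial_iso K L"
  shows "simplicial_iso L K"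
proof -
  obtain f where f: "bij_betw f (\<Union>K) (\<Union>L)"
    and fK: "\<forall>\<sigma>. \<sigma> \<subseteq> \<Union>K \<longrightarrow> (\<sigma> \<in> K \<longleftrightarrow> f ` \<sigma> \<in> L)"
    using assms by (rule simplicial_isoE)
  let ?g = "inv_into (\<Union>K) f"
  have g: "bij_betw ?g (\<Union>L) (\<Union>K)" using f by (rule bij_betw_inv_into)
  have "\<sigma> \<in> L \<longleftrightarrow> ?g ` \<sigma> \<in> K" if "\<sigma> \<subseteq> \<Union>L" for \<sigma>
  proof -
    have "?g ` \<sigma> \<subseteq> \<Union>K" using image_mono[OF that, of ?g] bij_betw_imp_surj_on[OF g] by simp
    moreover have "f ` ?g ` \<sigma> = \<sigma>"
      using f that by (metis bij_betw_imp_surj_on image_inv_into_cancel)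
    ultimately show ?thesis using fK by metis
  qed
  with g show ?thesis by (rule simplicial_isoI)
qed

lemma simplicial_iso_trans:
  assumes "simplicial_iso K L" "simplicial_iso L M"
  shows "simplicial_iso K M"
proof -
  obtain f where f: "bij_betw f (\<Union>K) (\<Union>L)"
    and fK: "\<forall>\<sigma>. \<sigma> \<subseteq> \<Union>K \<longrightarrow> (\<sigma> \<in> K \<longleftrightarrow> f ` \<sigma> \<in> L)"
    using assms(1) by (rule simplicial_isoE)
  obtain g where g: "bij_betw g (\<Union>L) (\<Union>M)"
    and gL: "\<forall>\<sigma>. \<sigma> \<subseteq> \<Union>L \<longrightarrow> (\<sigma> \<in> L \<longleftrightarrow> g ` \<sigma> \<in> M)"
    using assms(2) by (rule simplicial_isoE)
  have "bij_betw (g \<circ> f) (\<Union>K) (\<Union>M)" using f g by (rule bij_betw_trans)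
  moreover have "\<sigma> \<in> K \<longleftrightarrow> (g \<circ> f) ` \<sigma> \<in> M" if "\<sigma> \<subseteq> \<Union>K" for \<sigma>
  proof -
    have "f ` \<sigma> \<subseteq> \<Union>L" using image_mono[OF that, of f] bij_betw_imp_surj_on[OF f] by simp
    then show ?thesis using fK that gL by (simp add: image_comp)
  qed
  ultimately show ?thesis by (rule simplicial_isoI)
qed

lemma simplicial_iso_image:
  assumes inj: "inj_on f (\<Union>K)"
  shows "simplicial_iso K ((`) f ` K)"
proof -
  have "bij_betw f (\<Union>K) (\<Union>((`) f ` K))"
    using inj unfolding bij_betw_def by blast
  moreover have "\<sigma> \<in> K \<longleftrightarrow> f ` \<sigma> \<in> (`) f ` K" if "\<sigma> \<subseteq> \<Union>K" for \<sigma>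
  proof
    assume "f ` \<sigma> \<in> (`) f ` K"
    then obtain \<tau> where "\<tau> \<in> K" "f ` \<sigma> = f ` \<tau>" by blast
    then show "\<sigma> \<in> K"
      using inj_on_image_eq_iff[OF inj that, of \<tau>] by (simp add: Sup_upper)
  qed blast
  ultimately show ?thesis by (rule simplicial_isoI)
qed

lemma simplicial_iso_refl: "simplicial_iso K K"
  unfolding simplicial_iso_def by (rule exI[of _ id]) simp

lemma finite_complex_image:
  assumes "finite_complex K"
  shows "finite_complex ((`) f ` K)"
proof -
  have "\<rho> \<in> (`) f ` K" if "\<tau> \<in> K" "\<rho> \<subseteq> f ` \<tau>" for \<tau> \<rho>
  proof -
    obtain \<tau>' where "\<tau>' \<subseteq> \<tau>" "\<rho> = f ` \<tau>'" using \<open>\<rho> \<subseteq> f ` \<tau>\<close> by (meson subset_imageE)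
    then show ?thesis using assms that(1) unfolding finite_complex_def by blast
  qed
  then show ?thesis using assms unfolding finite_complex_def by auto
qed

lemma ex_nat_inj_on:
  assumes "finite (V :: 'a set)"
  obtains f :: "'a \<Rightarrow> nat" where "inj_on f V"
  using finite_imp_inj_to_nat_seg[OF assms] by blast

lemma same_simple_homotopy_typeI:
  assumes "finite_complex K" "finite_complex L" "finite_complex K'" "finite_complex L'"
    and "simplicial_iso K K'" "simple_homotopy_step\<^sup>*\<^sup>* K' L'" "simplicial_iso L' L"
  shows "same_simple_homotopy_type K L"
  using assms unfolding same_simple_homotopy_type_def by blast

lemma same_simple_homotopy_typeE:
  assumes "same_simple_homotopy_type K L"
  obtains K' L' where "finite_complex K" "finite_complex L" "finite_complex K'" "finite_complex L'"
    "simplicial_iso K K'" "simple_homotopy_step\<^sup>*\<^sup>* K' L'" "simplicial_iso L' L"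
  using assms unfolding same_simple_homotopy_type_def by blast

lemma simple_homotopy_step_rtranclp_sym:
  assumes "simple_homotopy_step\<^sup>*\<^sup>* K L"
  shows "simple_homotopy_step\<^sup>*\<^sup>* L K"
proof -
  have "symp simple_homotopy_step"
    unfolding symp_def simple_homotopy_step_def using simplicial_iso_sym by blast
  then show ?thesis using assms by (meson sympD symp_rtranclp)
qed

lemma same_simple_homotopy_type_sym:
  assumes "same_simple_homotopy_type K L"
  shows "same_simple_homotopy_type L K"
  using assms
proof (rule same_simple_homotopy_typeE)
  fix K' L'
  assume *: "finite_complex K" "finite_complex L" "finite_complex K'" "finite_complex L'"
    "simplicial_iso K K'" "simple_homotopy_step\<^sup>*\<^sup>* K' L'" "simplicial_iso L' L"
  show ?thesis
    by (rule same_simple_homotopy_typeI[OF *(2,1,4,3) simplicial_iso_sym[OF *(7)]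
          simple_homotopy_step_rtranclp_sym[OF *(6)] simplicial_iso_sym[OF *(5)]])
qed

lemma same_simple_homotopy_type_trans [trans]:
  assumes "same_simple_homotopy_type K L" "same_simple_homotopy_type L M"
  shows "same_simple_homotopy_type K M"
  using assms(1)
proof (rule same_simple_homotopy_typeE)
  fix K' L'
  assume 1: "finite_complex K" "finite_complex L" "finite_complex K'" "finite_complex L'"
    "simplicial_iso K K'" "simple_homotopy_step\<^sup>*\<^sup>* K' L'" "simplicial_iso L' L"
  show ?thesis
    using assms(2)
  proof (rule same_simple_homotopy_typeE)
    fix L'' M'
    assume 2: "finite_complex L" "finite_complex M" "finite_complex L''" "finite_complex M'"
      "simplicial_iso L L''" "simple_homotopy_step\<^sup>*\<^sup>* L'' M'" "simplicial_iso M' M"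
    \<comment> \<open>\<open>L'\<close> and \<open>L''\<close> are two relabellings of
      \<open>L\<close>; since an isomorphism counts as a step, it glues the two chains.\<close>
    have "simple_homotopy_step L' L''"
      using simplicial_iso_trans[OF 1(7) 2(5)] unfolding simple_homotopy_step_def by blast
    then have "simple_homotopy_step\<^sup>*\<^sup>* K' M'"
      using 1(6) 2(6) by (meson rtranclp.rtrancl_into_rtrancl rtranclp_trans)
    then show ?thesis
      using same_simple_homotopy_typeI[OF 1(1) 2(2) 1(3) 2(4) 1(5) _ 2(7)] by blast
  qed
qed

lemma simplicial_iso_imp_same_simple_homotopy_type:
  assumes "finite_complex K" "finite_complex L" "simplicial_iso K L"
  shows "same_simple_homotopy_type K L"
proof -
  obtain f :: "'a \<Rightarrow> nat" where f: "inj_on f (\<Union>K)"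
    using finite_complex_finite_Union[OF assms(1)] by (rule ex_nat_inj_on)
  let ?K = "(`) f ` K"
  have iso: "simplicial_iso K ?K" using f by (rule simplicial_iso_image)
  have fc: "finite_complex ?K" using assms(1) by (rule finite_complex_image)
  show ?thesis
    by (rule same_simple_homotopy_typeI[OF assms(1,2) fc fc iso rtranclp.rtrancl_refl
          simplicial_iso_trans[OF simplicial_iso_sym[OF iso] assms(3)]])
qed

lemma same_simple_homotopy_type_refl:
  "finite_complex K \<Longrightarrow> same_simple_homotopy_type K K"
  by (rule simplicial_iso_imp_same_simple_homotopy_type[OF _ _ simplicial_iso_refl])

text \<open>A survivor containing \<open>\<sigma>\<close> or \<open>\<tau>\<close> would properly
  contain \<open>\<sigma>\<close> and hence be \<open>\<tau>\<close>, so the survivors are closed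
  under taking faces.\<close>

lemma elementary_collapse_imp_finite_complex:
  assumes "elementary_collapse K L"
  shows "finite_complex L"
proof -
  obtain \<sigma> \<tau> where fc: "finite_complex K" and st: "\<sigma> \<in> K" "\<tau> \<in> K" "\<sigma> \<noteq> {}" "\<sigma> \<subset> \<tau>"
    and free: "\<And>\<rho>. \<rho> \<in> K \<Longrightarrow> \<sigma> \<subset> \<rho> \<Longrightarrow> \<rho> = \<tau>" and L: "L = K - {\<sigma>, \<tau>}"
    using assms unfolding elementary_collapse_def by blast
  have "\<rho> \<in> L" if "\<rho>' \<in> L" "\<rho> \<subseteq> \<rho>'" for \<rho> \<rho>'
  proof -
    have "\<rho> \<in> K" using fc that L unfolding finite_complex_def by blast
    moreover have "\<rho>' \<in> K" "\<rho>' \<noteq> \<sigma>" "\<rho>' \<noteq> \<tau>" using that L by auto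
    ultimately show ?thesis using free[of \<rho>'] that(2) st(4) L by blast
  qed
  moreover have "finite L" "\<forall>\<sigma>\<in>L. finite \<sigma>" "{} \<in> L"
    using fc st L unfolding finite_complex_def by auto
  ultimately show ?thesis unfolding finite_complex_def by blast
qed

lemma elementary_collapse_image:
  assumes "elementary_collapse K L" and inj: "inj_on f (\<Union>K)"
  shows "elementary_collapse ((`) f ` K) ((`) f ` L)"
proof -
  obtain \<sigma> \<tau> where fc: "finite_complex K" and st: "\<sigma> \<in> K" "\<tau> \<in> K" "\<sigma> \<noteq> {}" "\<sigma> \<subset> \<tau>"
    "card \<tau> = card \<sigma> + 1"
    and free: "\<And>\<rho>. \<rho> \<in> K \<Longrightarrow> \<sigma> \<subset> \<rho> \<Longrightarrow> \<rho> = \<tau>" and L: "L = K - {\<sigma>, \<tau>}"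
    using assms(1) unfolding elementary_collapse_def by blast
  have injs: "inj_on ((`) f) K"
    using inj_on_image[OF inj] .
  have card: "card (f ` \<rho>) = card \<rho>" if "\<rho> \<in> K" for \<rho>
    using that inj by (meson Sup_upper card_image inj_on_subset)
  have sub: "f ` \<sigma> \<subset> f ` \<rho> \<longleftrightarrow> \<sigma> \<subset> \<rho>" if "\<rho> \<in> K" for \<rho>
  proof -
    have "\<sigma> \<subseteq> \<Union>K" "\<rho> \<subseteq> \<Union>K" using that st(1) by blast+
    then have "f ` \<sigma> \<subseteq> f ` \<rho> \<longleftrightarrow> \<sigma> \<subseteq> \<rho>" "f ` \<sigma> = f ` \<rho> \<longleftrightarrow> \<sigma> = \<rho>"
      using inj unfolding inj_on_def by blast+
    then show ?thesis by (simp add: psubset_eq)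
  qed
  have "f ` \<sigma> \<in> (`) f ` K" "f ` \<tau> \<in> (`) f ` K" using st by blast+
  moreover have "f ` \<sigma> \<noteq> {}" "f ` \<sigma> \<subset> f ` \<tau>" "card (f ` \<tau>) = card (f ` \<sigma>) + 1"
    using st sub card by auto
  moreover have "\<forall>\<rho>\<in>(`) f ` K. f ` \<sigma> \<subset> \<rho> \<longrightarrow> \<rho> = f ` \<tau>" using free sub by blast
  moreover have "(`) f ` L = (`) f ` K - {f ` \<sigma>, f ` \<tau>}"
    using L inj_on_image_set_diff[OF injs, of K "{\<sigma>, \<tau>}"] st by simp
  ultimately show ?thesis
    using finite_complex_image[OF fc] unfolding elementary_collapse_def
    by (intro conjI exI[of _ "f ` \<sigma>"] exI[of _ "f ` \<tau>"])
qed

text \<open>Steps exist only between complexes on \<open>nat\<close>, so the collapse is first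
  transported along an injection of the vertices.\<close>

lemma elementary_collapse_imp_same_simple_homotopy_type:
  assumes "elementary_collapse K L"
  shows "same_simple_homotopy_type K L"
proof -
  have fc: "finite_complex K" "finite_complex L"
    using assms elementary_collapse_imp_finite_complex[OF assms]
    unfolding elementary_collapse_def by simp_all
  obtain f :: "'a \<Rightarrow> nat" where f: "inj_on f (\<Union>K)"
    using finite_complex_finite_Union[OF fc(1)] by (rule ex_nat_inj_on)
  have "L \<subseteq> K" using assms unfolding elementary_collapse_def by auto
  then have f': "inj_on f (\<Union>L)" using f by (meson Union_mono inj_on_subset)
  have "simple_homotopy_step ((`) f ` K) ((`) f ` L)"
    using elementary_collapse_image[OF assms f] unfolding simple_homotopy_step_def by blast
  then have step: "simple_homotopy_step\<^sup>*\<^sup>* ((`) f ` K) ((`) f ` L)" by blast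
  show ?thesis
    by (rule same_simple_homotopy_typeI[OF fc finite_complex_image[OF fc(1)]
          finite_complex_image[OF fc(2)] simplicial_iso_image[OF f] step
          simplicial_iso_sym[OF simplicial_iso_image[OF f']]])
qed

section \<open>Collapsing stars\<close>

text \<open>The faces over \<open>\<sigma>\<close> fall into pairs \<open>\<rho>\<close>,
  \<open>insert w \<rho>\<close> with \<open>w\<close> outside \<open>\<rho>\<close>. A maximal such
  \<open>\<rho>\<close> is free, and removing its pair preserves the cone condition, so the pairs
  can be removed one by one.\<close>

lemma collapse_star:
  assumes "finite_complex K" and "\<sigma> \<noteq> {}" and "w \<notin> \<sigma>"
    and "\<And>\<rho>. \<rho> \<in> K \<Longrightarrow> \<sigma> \<subseteq> \<rho> \<Longrightarrow> insert w \<rho> \<in> K"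
  shows "same_simple_homotopy_type K {\<rho>\<in>K. \<not> \<sigma> \<subseteq> \<rho>}"
  using assms
proof (induction "card K" arbitrary: K rule: less_induct)
  case less
  have finK: "finite K" using less.prems(1) unfolding finite_complex_def by blast
  show ?case
  proof (cases "\<exists>\<rho>\<in>K. \<sigma> \<subseteq> \<rho>")
    case False
    then have "{\<rho>\<in>K. \<not> \<sigma> \<subseteq> \<rho>} = K" by blast
    then show ?thesis using less.prems(1) same_simple_homotopy_type_refl by simp
  next
    case True
    let ?B = "{\<rho>\<in>K. \<sigma> \<subseteq> \<rho> \<and> w \<notin> \<rho>}"
    have "\<sigma> \<in> K" using True less.prems(1) unfolding finite_complex_def by blast
    then have "?B \<noteq> {}" using less.prems(3) by blast
    moreover have "finite ?B" using finK by simp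
    ultimately obtain \<rho> where \<rho>: "\<rho> \<in> ?B" and max: "\<And>\<rho>'. \<rho>' \<in> ?B \<Longrightarrow> \<rho> \<subseteq> \<rho>' \<Longrightarrow> \<rho> = \<rho>'"
      by (meson finite_has_maximal)
    let ?L = "K - {\<rho>, insert w \<rho>}"
    have ins: "insert w \<rho> \<in> K" using \<rho> less.prems(4) by blast
    \<comment> \<open>Without \<open>w\<close>, a larger face would be another member of
      \<open>?B\<close> above \<open>\<rho>\<close>; by maximality it is \<open>\<rho>\<close>
      itself.\<close>
    have free: "\<rho>' = insert w \<rho>" if "\<rho>' \<in> K" "\<rho> \<subset> \<rho>'" for \<rho>'
    proof -
      have "\<rho>' - {w} \<in> ?B" using that \<rho> less.prems(1) unfolding finite_complex_def by blast
      then have "\<rho> = \<rho>' - {w}" using max \<rho> that(2) by blast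
      then show ?thesis using that(2) by blast
    qed
    have "finite \<rho>" using \<rho> less.prems(1) unfolding finite_complex_def by blast
    then have coll: "elementary_collapse K ?L"
      unfolding elementary_collapse_def using \<rho> ins free less.prems(1,2)
      by (intro conjI exI[of _ \<rho>] exI[of _ "insert w \<rho>"]) auto
    have "card ?L < card K" using finK \<rho> by (intro psubset_card_mono) auto
    moreover have "finite_complex ?L" using coll by (rule elementary_collapse_imp_finite_complex)
    moreover have "insert w \<rho>' \<in> ?L" if "\<rho>' \<in> ?L" "\<sigma> \<subseteq> \<rho>'" for \<rho>'
    proof -
      have "insert w \<rho>' \<in> K" using that less.prems(4) by blast
      moreover have "insert w \<rho>' \<noteq> \<rho>" using \<rho> by blast
      moreover have "insert w \<rho>' \<noteq> insert w \<rho>"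
      proof
        assume eq: "insert w \<rho>' = insert w \<rho>"
        show False
        proof (cases "w \<in> \<rho>'")
          case True
          then show False using eq that by (simp add: insert_absorb)
        next
          case False
          then have "\<rho>' = \<rho>" using eq \<rho> by (simp add: insert_ident)
          then show False using that by simp
        qed
      qed
      ultimately show ?thesis by simp
    qed
    ultimately have "same_simple_homotopy_type ?L {\<rho>\<in>?L. \<not> \<sigma> \<subseteq> \<rho>}"
      using less.hyps less.prems(2,3) by presburger
    moreover have "{\<rho>\<in>?L. \<not> \<sigma> \<subseteq> \<rho>} = {\<rho>\<in>K. \<not> \<sigma> \<subseteq> \<rho>}" using \<rho> by blast
    ultimately show ?thesis
      using same_simple_homotopy_type_trans[OF elementary_collapse_imp_same_simple_homotopy_type[OF coll]]
      by simp
  qed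
qed

lemma finite_complex_remove_stars:
  assumes "finite_complex K" and "{} \<notin> S"
  shows "finite_complex {\<rho>\<in>K. \<forall>\<sigma>\<in>S. \<not> \<sigma> \<subseteq> \<rho>}"
  unfolding finite_complex_def
proof (intro conjI ballI allI impI)
  show "finite {\<rho>\<in>K. \<forall>\<sigma>\<in>S. \<not> \<sigma> \<subseteq> \<rho>}"
    using assms(1) unfolding finite_complex_def by simp
  show "finite \<rho>" if "\<rho> \<in> {\<rho>\<in>K. \<forall>\<sigma>\<in>S. \<not> \<sigma> \<subseteq> \<rho>}" for \<rho>
    using assms(1) that unfolding finite_complex_def by simp
  show "{} \<in> {\<rho>\<in>K. \<forall>\<sigma>\<in>S. \<not> \<sigma> \<subseteq> \<rho>}"
    using assms unfolding finite_complex_def by auto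
  show "\<rho>' \<in> {\<rho>\<in>K. \<forall>\<sigma>\<in>S. \<not> \<sigma> \<subseteq> \<rho>}"
    if "\<rho> \<in> {\<rho>\<in>K. \<forall>\<sigma>\<in>S. \<not> \<sigma> \<subseteq> \<rho>}" "\<rho>' \<subseteq> \<rho>" for \<rho> \<rho>'
  proof -
    have "\<forall>\<rho>\<in>K. \<forall>\<rho>'. \<rho>' \<subseteq> \<rho> \<longrightarrow> \<rho>' \<in> K"
      using assms(1) unfolding finite_complex_def by (elim conjE)
    then have "\<rho>' \<in> K" using that by blast
    moreover have "\<not> \<sigma> \<subseteq> \<rho>'" if "\<sigma> \<in> S" for \<sigma>
      using that \<open>\<rho> \<in> _\<close> \<open>\<rho>' \<subseteq> \<rho>\<close> by (simp, meson subset_trans)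
    ultimately show ?thesis by simp
  qed
qed

text \<open>The last assumption says that adjoining an apex never completes another member of
  \<open>S\<close>. So the cone over the star of one member survives the removal of the other stars,
  whatever their order.\<close>

lemma collapse_stars:
  assumes "finite S" and "finite_complex K" and "{} \<notin> S"
    and w: "\<And>\<sigma>. \<sigma> \<in> S \<Longrightarrow> w \<sigma> \<notin> \<sigma>"
    and cone: "\<And>\<sigma> \<rho>. \<sigma> \<in> S \<Longrightarrow> \<rho> \<in> K \<Longrightarrow> \<sigma> \<subseteq> \<rho> \<Longrightarrow> insert (w \<sigma>) \<rho> \<in> K"
    and new: "\<And>\<sigma> \<rho> \<sigma>'. \<sigma> \<in> S \<Longrightarrow> \<rho> \<in> K \<Longrightarrow> \<sigma> \<subseteq> \<rho> \<Longrightarrow> \<sigma>' \<in> S \<Longrightarrow> \<sigma>' \<subseteq> insert (w \<sigma>) \<rho> \<Longrightarrow> \<sigma>' \<subseteq> \<rho>"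
  shows "same_simple_homotopy_type K {\<rho>\<in>K. \<forall>\<sigma>\<in>S. \<not> \<sigma> \<subseteq> \<rho>}"
proof -
  have "same_simple_homotopy_type K {\<rho>\<in>K. \<forall>\<sigma>\<in>T. \<not> \<sigma> \<subseteq> \<rho>}" if "T \<subseteq> S" for T
    using finite_subset[OF that \<open>finite S\<close>] that
  proof (induction T rule: finite_induct)
    case empty
    then show ?case using same_simple_homotopy_type_refl[OF assms(2)] by simp
  next
    case (insert \<sigma> T)
    let ?K = "{\<rho>\<in>K. \<forall>\<sigma>\<in>T. \<not> \<sigma> \<subseteq> \<rho>}"
    have "finite_complex ?K" using assms(2,3) insert.prems by (intro finite_complex_remove_stars) auto
    moreover have "insert (w \<sigma>) \<rho> \<in> ?K" if "\<rho> \<in> ?K" "\<sigma> \<subseteq> \<rho>" for \<rho>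
    proof -
      have \<sigma>: "\<sigma> \<in> S" "T \<subseteq> S" using insert.prems by auto
      have "\<not> \<sigma>' \<subseteq> insert (w \<sigma>) \<rho>" if "\<sigma>' \<in> T" for \<sigma>'
        using that new[OF \<sigma>(1) _ \<open>\<sigma> \<subseteq> \<rho>\<close>, of \<sigma>'] \<open>\<rho> \<in> ?K\<close> \<sigma>(2) by auto
      then show ?thesis using cone[OF \<sigma>(1) _ that(2)] that(1) by simp
    qed
    ultimately have "same_simple_homotopy_type ?K {\<rho>\<in>?K. \<not> \<sigma> \<subseteq> \<rho>}"
      using insert.prems assms(3) w by (intro collapse_star) auto
    moreover have "{\<rho>\<in>?K. \<not> \<sigma> \<subseteq> \<rho>} = {\<rho>\<in>K. \<forall>\<sigma>\<in>insert \<sigma> T. \<not> \<sigma> \<subseteq> \<rho>}" by blast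
    ultimately show ?case using insert.IH insert.prems same_simple_homotopy_type_trans by auto
  qed
  then show ?thesis by blast
qed

section \<open>Independence complexes of graphs and certified moves\<close>

text \<open>A bare relation suffices: it may be asymmetric, parallel edges disappear, and a loop
  \<open>E x x\<close> excludes \<open>x\<close>. Loops occur in the cylinder with one column and
  later serve to delete vertices.\<close>

definition ind :: "'a set \<Rightarrow> ('a \<Rightarrow> 'a \<Rightarrow> bool) \<Rightarrow> 'a set set" where
  "ind V E = {S. S \<subseteq> V \<and> (\<forall>x\<in>S. \<forall>y\<in>S. \<not> E x y)}"

lemma ind_iff: "S \<in> ind V E \<longleftrightarrow> S \<subseteq> V \<and> (\<forall>x\<in>S. \<forall>y\<in>S. \<not> E x y)"
  unfolding ind_def by simp

lemma finite_complex_ind: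
  assumes "finite V"
  shows "finite_complex (ind V E)"
proof -
  have "ind V E \<subseteq> Pow V" unfolding ind_def by auto
  then have "finite (ind V E)" using assms finite_subset by blast
  moreover have "finite S" if "S \<in> ind V E" for S
    using that assms finite_subset unfolding ind_def by auto
  moreover have "\<forall>S\<in>ind V E. \<forall>S'. S' \<subseteq> S \<longrightarrow> S' \<in> ind V E"
    unfolding ind_def by auto
  moreover have "{} \<in> ind V E" by (simp add: ind_iff)
  ultimately show ?thesis unfolding finite_complex_def by simp
qed

lemma ind_iso:
  assumes h: "bij_betw h W V" and "finite W"
    and adj: "\<And>x y. x \<in> W \<Longrightarrow> y \<in> W \<Longrightarrow> F x y \<longleftrightarrow> E (h x) (h y)"
  shows "same_simple_homotopy_type (ind V E) (ind W F)"
proof -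
  let ?W = "\<Union>(ind W F)"
  have "?W \<subseteq> W" by (auto simp: ind_iff)
  then have inj: "inj_on h ?W" using h inj_on_subset unfolding bij_betw_def by blast
  have img: "h ` T \<in> ind V E \<longleftrightarrow> T \<in> ind W F" if "T \<subseteq> W" for T
  proof -
    have "h ` T \<subseteq> V" using image_mono[OF that, of h] bij_betw_imp_surj_on[OF h] by simp
    moreover have "(\<forall>x\<in>h ` T. \<forall>y\<in>h ` T. \<not> E x y) \<longleftrightarrow> (\<forall>x\<in>T. \<forall>y\<in>T. \<not> F x y)"
      using adj that by (simp add: subset_iff)
    ultimately show ?thesis using that by (simp add: ind_iff)
  qed
  have "(`) h ` ind W F = ind V E"
  proof (intro subset_antisym subsetI)
    fix S assume "S \<in> (`) h ` ind W F"
    then obtain T where "T \<in> ind W F" "S = h ` T" by blast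
    then show "S \<in> ind V E" using img[of T] by (simp add: ind_iff)
  next
    fix S assume S: "S \<in> ind V E"
    then have "S \<subseteq> h ` W" using bij_betw_imp_surj_on[OF h] by (simp add: ind_iff)
    then obtain T where T: "T \<subseteq> W" "S = h ` T" by (rule subset_imageE)
    then show "S \<in> (`) h ` ind W F" using S img[of T] by simp
  qed
  then have "simplicial_iso (ind W F) (ind V E)" using simplicial_iso_image[OF inj] by simp
  moreover have "finite V" using h \<open>finite W\<close> bij_betw_finite by blast
  ultimately show ?thesis
    by (intro simplicial_iso_imp_same_simple_homotopy_type[OF _ _ simplicial_iso_sym]
        finite_complex_ind \<open>finite W\<close>)
qed

text \<open>A local part of a graph is given by neighbour lists. The predicate \<open>cl\<close> marks the closed
  vertices, all of whose neighbours are listed; the other listed vertices may have further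
  neighbours.\<close>

type_synonym 'a nbrs = "('a \<times> 'a list) list"

definition nbr :: "'a nbrs \<Rightarrow> 'a \<Rightarrow> 'a list" where
  "nbr A x = (case map_of A x of None \<Rightarrow> [] | Some l \<Rightarrow> l)"

abbreviation adj :: "'a nbrs \<Rightarrow> 'a \<Rightarrow> 'a \<Rightarrow> bool" where
  "adj A x y \<equiv> y \<in> set (nbr A x)"

definition is_key :: "'a nbrs \<Rightarrow> 'a \<Rightarrow> bool" where
  "is_key A x \<longleftrightarrow> map_of A x \<noteq> None"

definition closed_verts :: "('a \<Rightarrow> bool) \<Rightarrow> 'a nbrs \<Rightarrow> 'a set" where
  "closed_verts cl A = {x. is_key A x \<and> cl x}"

definition add_edge :: "'a \<Rightarrow> 'a \<Rightarrow> 'a nbrs \<Rightarrow> 'a nbrs" where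
  "add_edge u v A =
     map (\<lambda>(x, l). (x, if x = u then v # l else if x = v then u # l else l)) A"

definition del_edge :: "'a \<Rightarrow> 'a \<Rightarrow> 'a nbrs \<Rightarrow> 'a nbrs" where
  "del_edge u v A =
     map (\<lambda>(x, l). (x, if x = u then removeAll v l else if x = v then removeAll u l else l)) A"

definition del_vert :: "'a \<Rightarrow> 'a nbrs \<Rightarrow> 'a nbrs" where
  "del_vert v A = map (\<lambda>(x, l). (x, removeAll v l)) (filter (\<lambda>(x, l). x \<noteq> v) A)"

definition ins_vert :: "'a \<Rightarrow> 'a list \<Rightarrow> 'a nbrs \<Rightarrow> 'a nbrs" where
  "ins_vert v ns A = (v, ns) # map (\<lambda>(x, l). (x, if x \<in> set ns then v # l else l)) A"

section \<open>Effect of the graph operations on neighbour lists\<close>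

lemma map_of_map_key: "map_of (map (\<lambda>(x, l). (x, f x l)) A) x = map_option (f x) (map_of A x)"
  by (induction A) auto

lemma nbr_map_key:
  "nbr (map (\<lambda>(x, l). (x, f x l)) A) x = (if is_key A x then f x (nbr A x) else [])"
  unfolding nbr_def is_key_def map_of_map_key by (cases "map_of A x") auto

lemma is_key_map_key: "is_key (map (\<lambda>(x, l). (x, f x l)) A) x = is_key A x"
  unfolding is_key_def map_of_map_key by simp

lemma not_is_key_nbr: "\<not> is_key A x \<Longrightarrow> nbr A x = []"
  unfolding nbr_def is_key_def by auto

lemma adj_is_key: "adj A x y \<Longrightarrow> is_key A x"
  using not_is_key_nbr by force

lemma map_of_filter_neq: "map_of (filter (\<lambda>(x, l). x \<noteq> v) A) x = (if x = v then None else map_of A x)"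
  by (induction A) auto

lemma is_key_edge [simp]:
  "is_key (add_edge u v A) x = is_key A x" "is_key (del_edge u v A) x = is_key A x"
  unfolding add_edge_def del_edge_def by (rule is_key_map_key)+

lemma is_key_del_vert: "is_key (del_vert v A) x \<longleftrightarrow> is_key A x \<and> x \<noteq> v"
  unfolding del_vert_def is_key_map_key by (simp add: is_key_def map_of_filter_neq)

lemma is_key_ins_vert: "is_key (ins_vert v ns A) x \<longleftrightarrow> is_key A x \<or> x = v"
  using is_key_map_key[of "\<lambda>x l. if x \<in> set ns then v # l else l" A x]
  unfolding ins_vert_def is_key_def by auto

lemma adj_add_edge:
  assumes "u \<noteq> v" "is_key A u" "is_key A v"
  shows "adj (add_edge u v A) x y \<longleftrightarrow> adj A x y \<or> x = u \<and> y = v \<or> x = v \<and> y = u"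
proof -
  have "nbr (add_edge u v A) x =
      (if is_key A x then if x = u then v # nbr A x else if x = v then u # nbr A x else nbr A x else [])"
    unfolding add_edge_def by (rule nbr_map_key)
  then show ?thesis using assms not_is_key_nbr[of A x] by (cases "is_key A x") auto
qed

lemma adj_del_edge:
  assumes "u \<noteq> v"
  shows "adj (del_edge u v A) x y \<longleftrightarrow> adj A x y \<and> \<not> (x = u \<and> y = v \<or> x = v \<and> y = u)"
proof -
  have "nbr (del_edge u v A) x =
      (if is_key A x then if x = u then removeAll v (nbr A x)
       else if x = v then removeAll u (nbr A x) else nbr A x else [])"
    unfolding del_edge_def by (rule nbr_map_key)
  then show ?thesis using assms not_is_key_nbr[of A x] by (cases "is_key A x") auto
qed

lemma adj_del_vert: "adj (del_vert v A) x y \<longleftrightarrow> adj A x y \<and> x \<noteq> v \<and> y \<noteq> v"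
proof -
  let ?B = "filter (\<lambda>(x, l). x \<noteq> v) A"
  have "nbr (del_vert v A) x = (if is_key ?B x then removeAll v (nbr ?B x) else [])"
    unfolding del_vert_def by (rule nbr_map_key)
  moreover have "nbr ?B x = (if x = v then [] else nbr A x)"
    unfolding nbr_def map_of_filter_neq by simp
  moreover have "is_key ?B x \<longleftrightarrow> is_key A x \<and> x \<noteq> v"
    unfolding is_key_def map_of_filter_neq by simp
  ultimately have "nbr (del_vert v A) x = (if is_key A x \<and> x \<noteq> v then removeAll v (nbr A x) else [])"
    by simp
  then show ?thesis
    using not_is_key_nbr[of A x] by (cases "is_key A x"; cases "x = v") simp_all
qed

lemma adj_ins_vert:
  assumes "symp (adj A)" "\<not> is_key A v" "v \<notin> set ns" "\<forall>x\<in>set ns. is_key A x"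
  shows "adj (ins_vert v ns A) x y \<longleftrightarrow> adj A x y \<or> x = v \<and> y \<in> set ns \<or> x \<in> set ns \<and> y = v"
proof (cases "x = v")
  case True
  then have "nbr (ins_vert v ns A) x = ns" unfolding ins_vert_def nbr_def by simp
  then show ?thesis using True assms not_is_key_nbr[of A v] by auto
next
  case False
  then have "nbr (ins_vert v ns A) x = nbr (map (\<lambda>(x, l). (x, if x \<in> set ns then v # l else l)) A) x"
    unfolding ins_vert_def nbr_def by simp
  also have "\<dots> = (if is_key A x then if x \<in> set ns then v # nbr A x else nbr A x else [])"
    by (rule nbr_map_key)
  finally show ?thesis
    using False assms not_is_key_nbr[of A x] by (cases "is_key A x") auto
qed

text \<open>The faces that contain \<open>S\<close> avoid \<open>X\<close>. If moreover every neighbour of \<open>u\<close> lies in \<open>X\<close>, then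
  their links are cones with apex \<open>u\<close>; a pair \<open>(u, v)\<close> of the list \<open>c\<close> removes the faces that
  contain \<open>S\<close> and \<open>v\<close>.\<close>

definition apex :: "('a \<Rightarrow> bool) \<Rightarrow> 'a nbrs \<Rightarrow> 'a list \<Rightarrow> 'a list \<Rightarrow> 'a \<Rightarrow> bool" where
  "apex cl A S X u \<longleftrightarrow>
     cl u \<and> is_key A u \<and> u \<notin> set S \<and> u \<notin> set X \<and> (\<forall>x\<in>set (nbr A u). x \<in> set X)"

fun cone_check :: "('a \<Rightarrow> bool) \<Rightarrow> 'a nbrs \<Rightarrow> 'a list \<Rightarrow> 'a list \<Rightarrow> ('a \<times> 'a) list \<Rightarrow> 'a \<Rightarrow> bool" where
  "cone_check cl A S X [] w = apex cl A S X w"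
| "cone_check cl A S X ((u, v) # c) w =
     (apex cl A (v # S) (nbr A v @ X) u \<and> cone_check cl A S (v # X) c w)"

text \<open>The last two arguments of a move are the certificate for \<open>cone_check\<close>. A removed edge or an
  inserted vertex is certified in the graph after the move.\<close>

datatype 'a move =
    Add 'a 'a "('a \<times> 'a) list" 'a
  | Rem 'a 'a "('a \<times> 'a) list" 'a
  | Del 'a "('a \<times> 'a) list" 'a
  | Ins 'a "'a list" "('a \<times> 'a) list" 'a

text \<open>Only closed vertices are deleted or inserted, since all edges at such a vertex must be
  visible. Edges may also join open vertices; this is how the two ends of a window get
  connected.\<close>

fun do_move :: "('a \<Rightarrow> bool) \<Rightarrow> 'a move \<Rightarrow> 'a nbrs \<Rightarrow> 'a nbrs option" where
  "do_move cl (Add u v c w) A =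
     (if u \<noteq> v \<and> is_key A u \<and> is_key A v \<and> cone_check cl A [u, v] (nbr A u @ nbr A v) c w
      then Some (add_edge u v A) else None)"
| "do_move cl (Rem u v c w) A =
     (let A' = del_edge u v A in
      if u \<noteq> v \<and> v \<in> set (nbr A u) \<and> cone_check cl A' [u, v] (nbr A' u @ nbr A' v) c w
      then Some A' else None)"
| "do_move cl (Del v c w) A =
     (if cl v \<and> is_key A v \<and> cone_check cl A [v] (nbr A v) c w then Some (del_vert v A) else None)"
| "do_move cl (Ins v ns c w) A =
     (let A' = ins_vert v ns A in
      if cl v \<and> \<not> is_key A v \<and> v \<notin> set ns \<and> (\<forall>x\<in>set ns. is_key A x) \<and> cone_check cl A' [v] ns c w
      then Some A' else None)"

fun do_moves :: "('a \<Rightarrow> bool) \<Rightarrow> 'a move list \<Rightarrow> 'a nbrs \<Rightarrow> 'a nbrs option" where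
  "do_moves cl [] A = Some A"
| "do_moves cl (m # ms) A = (case do_move cl m A of None \<Rightarrow> None | Some A' \<Rightarrow> do_moves cl ms A')"

section \<open>Soundness of the moves inside fixed surroundings\<close>

locale graph_window =
  fixes cl :: "'a \<Rightarrow> bool" and U :: "'a set" and R :: "'a \<Rightarrow> 'a \<Rightarrow> bool"
  assumes finite_U: "finite U"
    and U_open: "x \<in> U \<Longrightarrow> \<not> cl x"
    and R_open: "R x y \<Longrightarrow> \<not> cl x \<and> \<not> cl y"
begin

text \<open>Open keys of \<open>A\<close> contribute only adjacencies; as vertices they are supplied
  by \<open>U\<close>. An edge between open vertices may be present both in \<open>R\<close> and in
  the lists.\<close>

definition whole :: "'a nbrs \<Rightarrow> 'a set set" where
  "whole A = ind (U \<union> closed_verts cl A) (\<lambda>x y. R x y \<or> adj A x y)"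

lemma finite_complex_whole: "finite_complex (whole A)"
proof -
  have "closed_verts cl A \<subseteq> fst ` set A"
    unfolding closed_verts_def is_key_def by (auto simp: map_of_eq_None_iff)
  then have "finite (closed_verts cl A)" using finite_subset by blast
  then show ?thesis unfolding whole_def using finite_U by (intro finite_complex_ind) simp
qed

text \<open>\<open>K\<close> stands for what earlier pairs of the certificate have left of
  \<open>whole A\<close>. The last assumption says that among the faces over \<open>S\<close> only
  faces meeting \<open>X\<close> have been lost, so a cone with apex outside \<open>X\<close> stays
  inside \<open>K\<close>.\<close>

lemma cone_check_sound:
  assumes "cone_check cl A S X c w" and "symp (adj A)" and "S \<noteq> []"
    and "finite_complex K" and "K \<subseteq> whole A"
    and "\<And>\<rho>. \<rho> \<in> K \<Longrightarrow> set S \<subseteq> \<rho> \<Longrightarrow> \<rho> \<inter> set X = {}"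
    and "\<And>\<rho> x. \<rho> \<in> K \<Longrightarrow> set S \<subseteq> \<rho> \<Longrightarrow> x \<notin> set X \<Longrightarrow> insert x \<rho> \<in> whole A \<Longrightarrow> insert x \<rho> \<in> K"
  shows "same_simple_homotopy_type K {\<rho>\<in>K. \<not> set S \<subseteq> \<rho>}"
proof -
  \<comment> \<open>The listed neighbours of an apex lie in \<open>X'\<close>, which the face
    avoids, and a closed vertex has no edge in \<open>R\<close>.\<close>
  have ins: "insert u \<rho> \<in> whole A"
    if "\<rho> \<in> whole A" "apex cl A S' X' u" "\<rho> \<inter> set X' = {}" for u \<rho> S' X'
  proof -
    have u: "cl u" "is_key A u" "u \<notin> set X'" "\<And>x. adj A u x \<Longrightarrow> x \<in> set X'"
      using that(2) unfolding apex_def by auto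
    then have "\<not> adj A u x \<and> \<not> adj A x u" if "x \<in> insert u \<rho>" for x
      using that \<open>\<rho> \<inter> set X' = {}\<close> \<open>symp (adj A)\<close> by (metis disjoint_iff insertE sympD)
    moreover have "\<not> R u x \<and> \<not> R x u" for x using u(1) R_open by blast
    ultimately show ?thesis
      using that(1) u(1,2) unfolding whole_def ind_iff closed_verts_def by auto
  qed
  show ?thesis
    using assms(1,4-)
  proof (induction c arbitrary: K X)
    case Nil
    have "apex cl A S X w" using Nil.prems(1) by simp
    then show ?case
    proof (intro collapse_star)
      fix \<rho> assume \<rho>: "\<rho> \<in> K" "set S \<subseteq> \<rho>"
      have "\<rho> \<in> whole A" "\<rho> \<inter> set X = {}" using \<rho> Nil.prems(3,4) by auto
      then have "insert w \<rho> \<in> whole A" using ins \<open>apex cl A S X w\<close> by blast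
      then show "insert w \<rho> \<in> K" using \<rho> Nil.prems(5) \<open>apex cl A S X w\<close> unfolding apex_def by blast
    qed (use Nil.prems(2) \<open>S \<noteq> []\<close> in \<open>auto simp: apex_def\<close>)
  next
    case (Cons uv c)
    obtain u v where uv: "uv = (u, v)" by (cases uv)
    have ap: "apex cl A (v # S) (nbr A v @ X) u" and chk: "cone_check cl A S (v # X) c w"
      using Cons.prems(1) uv by auto
    \<comment> \<open>After this collapse every face over \<open>S\<close> avoids \<open>v\<close>,
      which is what allows \<open>v\<close> to join \<open>X\<close> for the rest of the
      certificate.\<close>
    let ?K = "{\<rho>\<in>K. \<not> set (v # S) \<subseteq> \<rho>}"
    have "same_simple_homotopy_type K ?K"
    proof (rule collapse_star)
      fix \<rho> assume \<rho>: "\<rho> \<in> K" "set (v # S) \<subseteq> \<rho>"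
      have \<rho>w: "\<rho> \<in> whole A" using \<rho> Cons.prems(3) by auto
      then have "\<rho> \<inter> set (nbr A v) = {}" using \<rho>(2) unfolding whole_def ind_iff by auto
      moreover have "\<rho> \<inter> set X = {}" using \<rho> Cons.prems(4) by auto
      ultimately have "insert u \<rho> \<in> whole A" using ins[OF \<rho>w ap] by auto
      then show "insert u \<rho> \<in> K" using \<rho> Cons.prems(5) ap unfolding apex_def by auto
    qed (use Cons.prems(2) ap in \<open>auto simp: apex_def\<close>)
    moreover have "same_simple_homotopy_type ?K {\<rho>\<in>?K. \<not> set S \<subseteq> \<rho>}"
    proof (rule Cons.IH[OF chk])
      show "finite_complex ?K"
        using finite_complex_remove_stars[OF Cons.prems(2), of "{set (v # S)}"] by simp
      show "?K \<subseteq> whole A" using Cons.prems(3) by auto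
      show "\<rho> \<inter> set (v # X) = {}" if "\<rho> \<in> ?K" "set S \<subseteq> \<rho>" for \<rho>
        using that Cons.prems(4) by auto
      show "insert x \<rho> \<in> ?K"
        if "\<rho> \<in> ?K" "set S \<subseteq> \<rho>" "x \<notin> set (v # X)" "insert x \<rho> \<in> whole A" for \<rho> x
        using that Cons.prems(5)[of \<rho> x] by auto
    qed
    moreover have "{\<rho>\<in>?K. \<not> set S \<subseteq> \<rho>} = {\<rho>\<in>K. \<not> set S \<subseteq> \<rho>}" by auto
    ultimately show ?case using same_simple_homotopy_type_trans by simp
  qed
qed

lemma cone_check_whole:
  assumes "cone_check cl A S X c w" and "symp (adj A)" and "S \<noteq> []"
    and "set X = (\<Union>s\<in>set S. set (nbr A s))"
  shows "same_simple_homotopy_type (whole A) {\<rho>\<in>whole A. \<not> set S \<subseteq> \<rho>}"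
proof (rule cone_check_sound[OF assms(1-3) finite_complex_whole order_refl])
  show "\<rho> \<inter> set X = {}" if "\<rho> \<in> whole A" "set S \<subseteq> \<rho>" for \<rho>
    using that unfolding assms(4) whole_def ind_iff by blast
qed

lemma whole_add_edge:
  assumes "\<And>x y. adj A' x y \<longleftrightarrow> adj A x y \<or> x = u \<and> y = v \<or> x = v \<and> y = u"
    and "\<And>x. is_key A' x = is_key A x"
  shows "whole A' = {\<rho>\<in>whole A. \<not> set [u, v] \<subseteq> \<rho>}"
  unfolding whole_def ind_def closed_verts_def assms by auto

lemma whole_del_vert:
  assumes "cl v" and "\<And>x y. x \<noteq> v \<Longrightarrow> y \<noteq> v \<Longrightarrow> adj A' x y \<longleftrightarrow> adj A x y"
    and "\<And>x. is_key A' x \<longleftrightarrow> is_key A x \<and> x \<noteq> v"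
  shows "whole A' = {\<rho>\<in>whole A. \<not> set [v] \<subseteq> \<rho>}"
proof -
  have "v \<notin> U" using assms(1) U_open by blast
  then have V: "U \<union> closed_verts cl A' = (U \<union> closed_verts cl A) - {v}"
    unfolding closed_verts_def assms(3) by auto
  have "\<rho> \<in> whole A' \<longleftrightarrow> \<rho> \<in> {\<rho>\<in>whole A. \<not> set [v] \<subseteq> \<rho>}" for \<rho>
  proof (cases "v \<in> \<rho>")
    case False
    then have "adj A' x y \<longleftrightarrow> adj A x y" if "x \<in> \<rho>" "y \<in> \<rho>" for x y using that assms(2) by metis
    then show ?thesis using False unfolding whole_def ind_iff V by auto
  qed (auto simp: whole_def ind_iff V)
  then show ?thesis by blast
qed

lemma do_move_sound:
  assumes "do_move cl m A = Some A'" and sym: "symp (adj A)"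
  shows "symp (adj A') \<and> same_simple_homotopy_type (whole A) (whole A')"
proof (cases m)
  case (Add u v c w)
  then have *: "u \<noteq> v" "is_key A u" "is_key A v" "cone_check cl A [u, v] (nbr A u @ nbr A v) c w"
    and A': "A' = add_edge u v A"
    using assms(1) by (auto split: if_splits)
  note adj = adj_add_edge[OF *(1-3)]
  have "symp (adj A')" using sym unfolding A' symp_def adj by blast
  moreover have "whole A' = {\<rho>\<in>whole A. \<not> set [u, v] \<subseteq> \<rho>}"
    unfolding A' using adj by (rule whole_add_edge) simp
  ultimately show ?thesis using cone_check_whole[OF *(4) sym] by simp
next
  case (Rem u v c w)
  then have *: "u \<noteq> v" "adj A u v" "cone_check cl A' [u, v] (nbr A' u @ nbr A' v) c w"
    and A': "A' = del_edge u v A"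
    using assms(1) by (auto simp: Let_def split: if_splits)
  note adj = adj_del_edge[OF *(1), where A = A]
  have sym': "symp (adj A')" using sym unfolding A' symp_def adj by blast
  have "adj A v u" using *(2) sym by (rule sympD[rotated])
  then have "whole A = {\<rho>\<in>whole A'. \<not> set [u, v] \<subseteq> \<rho>}"
    using *(1,2) unfolding A' by (intro whole_add_edge) (auto simp: adj)
  then show ?thesis
    using cone_check_whole[OF *(3) sym'] sym' same_simple_homotopy_type_sym by simp
next
  case (Del v c w)
  then have *: "cl v" "is_key A v" "cone_check cl A [v] (nbr A v) c w" and A': "A' = del_vert v A"
    using assms(1) by (auto split: if_splits)
  have "symp (adj A')" using sym unfolding A' symp_def adj_del_vert by blast
  moreover have "whole A' = {\<rho>\<in>whole A. \<not> set [v] \<subseteq> \<rho>}"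
    unfolding A' using *(1) by (rule whole_del_vert) (auto simp: adj_del_vert is_key_del_vert)
  ultimately show ?thesis using cone_check_whole[OF *(3) sym] by simp
next
  case (Ins v ns c w)
  then have *: "cl v" "\<not> is_key A v" "v \<notin> set ns" "\<forall>x\<in>set ns. is_key A x"
      "cone_check cl A' [v] ns c w" and A': "A' = ins_vert v ns A"
    using assms(1) by (auto simp: Let_def split: if_splits)
  note adj = adj_ins_vert[OF sym *(2-4)]
  have sym': "symp (adj A')" using sym unfolding A' symp_def adj by blast
  have "whole A = {\<rho>\<in>whole A'. \<not> set [v] \<subseteq> \<rho>}"
    using *(2) unfolding A' by (intro whole_del_vert *(1)) (auto simp: adj is_key_ins_vert)
  moreover have "nbr A' v = ns" unfolding A' ins_vert_def nbr_def by simp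
  ultimately show ?thesis
    using cone_check_whole[OF *(5) sym'] sym' same_simple_homotopy_type_sym by simp
qed

lemma do_moves_sound:
  assumes "do_moves cl ms A = Some A'" and "symp (adj A)"
  shows "symp (adj A') \<and> same_simple_homotopy_type (whole A) (whole A')"
  using assms
proof (induction ms arbitrary: A)
  case Nil
  then show ?case using same_simple_homotopy_type_refl[OF finite_complex_whole] by auto
next
  case (Cons m ms)
  then obtain B where B: "do_move cl m A = Some B" "do_moves cl ms B = Some A'"
    by (auto split: option.splits)
  then show ?case
    using do_move_sound[OF B(1)] Cons.IH[OF B(2)] Cons.prems(2) same_simple_homotopy_type_trans
    by blast
qed

end

section \<open>Cylindrical grids with additional isolated edges\<close>

text \<open>Row \<open>0\<close> is left free for the isolated edges. For \<open>n = 1\<close> the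
  last clauses produce the loops; for \<open>n = 2\<close> they repeat the ordinary edges, and
  parallel edges do not affect independence.\<close>

definition cyl_adj :: "nat \<Rightarrow> nat \<times> nat \<Rightarrow> nat \<times> nat \<Rightarrow> bool" where
  "cyl_adj n x y \<longleftrightarrow> fst x \<ge> 1 \<and> fst y \<ge> 1 \<and>
     (snd x = snd y \<and> (fst x = fst y + 1 \<or> fst y = fst x + 1) \<or>
      fst x = fst y \<and> (snd x = snd y + 1 \<or> snd y = snd x + 1 \<or> snd x = 1 \<and> snd y = n \<or> snd x = n \<and> snd y = 1))"

text \<open>\<open>wrap\<close> is idempotent for \<open>n \<ge> 1\<close>, so the ends in the
  quotient do not depend on which representative of an edge was kept.\<close>

lemma wrap_wrap_edge: "n \<ge> 1 \<Longrightarrow> wrap n ` wrap_edge n e = wrap n ` e"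
  unfolding wrap_edge_def by (simp add: image_image wrap_def)

lemma wrap_cyl_adj:
  assumes "n \<ge> 1" "a \<in> {1..m} \<times> {1..n + 1}" "b \<in> {1..m} \<times> {1..n + 1}" "grid_adj a b"
  shows "cyl_adj n (wrap n a) (wrap n b)"
proof -
  obtain i j i' j' where "a = (i, j)" "b = (i', j')" by (cases a, cases b)
  then show ?thesis
    using assms by (elim grid_adj_def[THEN iffD1, THEN disjE] conjE disjE)
      (simp_all add: cyl_adj_def wrap_def)
qed

lemma cyl_adj_lift:
  assumes "n \<ge> 1" "u \<in> {1..m} \<times> {1..n}" "v \<in> {1..m} \<times> {1..n}" "cyl_adj n u v"
  obtains a b where "a \<in> {1..m} \<times> {1..n + 1}" "b \<in> {1..m} \<times> {1..n + 1}" "grid_adj a b"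
    "wrap n a = u" "wrap n b = v"
proof -
  obtain i j i' j' where uv: "u = (i, j)" "v = (i', j')" by (cases u, cases v)
  have wr: "wrap n u = u" "wrap n v = v" using assms(2,3) uv by (auto simp: wrap_def)
  consider "grid_adj u v" | "i = i'" "j = 1" "j' = n" | "i = i'" "j = n" "j' = 1"
    using assms(4) uv unfolding cyl_adj_def grid_adj_def by auto
  then show ?thesis
  proof cases
    case 1
    then show ?thesis using that[of u v] assms(2,3) wr by auto
  next
    case 2
    then show ?thesis
      using that[of "(i, n + 1)" v] assms(1-3) wr uv by (auto simp: wrap_def grid_adj_def)
  next
    case 3
    then show ?thesis
      using that[of u "(i', n + 1)"] assms(1-3) wr uv by (auto simp: wrap_def grid_adj_def)
  qed
qed

lemma cyl_graph_adj:
  assumes "n \<ge> 1" "u \<in> {1..m} \<times> {1..n}" "v \<in> {1..m} \<times> {1..n}"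
  shows "(\<exists>e\<in>edges (cyl_graph m n). ends (cyl_graph m n) e = {u, v}) \<longleftrightarrow> cyl_adj n u v"
proof -
  let ?P = "{1..m} \<times> {1..n + 1}"
  have "(\<exists>e\<in>edges (cyl_graph m n). ends (cyl_graph m n) e = {u, v}) \<longleftrightarrow>
      (\<exists>a\<in>?P. \<exists>b\<in>?P. grid_adj a b \<and> {wrap n a, wrap n b} = {u, v})"
  proof -
    have "(\<exists>e\<in>edges (cyl_graph m n). ends (cyl_graph m n) e = {u, v}) \<longleftrightarrow>
        (\<exists>e\<in>{{a, b} | a b. a \<in> ?P \<and> b \<in> ?P \<and> grid_adj a b}. wrap n ` e = {u, v})"
      using wrap_wrap_edge[OF assms(1)] by (simp add: cyl_graph_def grid_graph_def)
    moreover have "wrap n ` {a, b} = {wrap n a, wrap n b}" for a b by simp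
    ultimately show ?thesis by (simp only: bex_simps mem_Collect_eq) metis
  qed
  also have "\<dots> \<longleftrightarrow> cyl_adj n u v"
  proof
    assume "\<exists>a\<in>?P. \<exists>b\<in>?P. grid_adj a b \<and> {wrap n a, wrap n b} = {u, v}"
    then obtain a b where ab: "a \<in> ?P" "b \<in> ?P" "grid_adj a b" "{wrap n a, wrap n b} = {u, v}" by auto
    have "cyl_adj n (wrap n a) (wrap n b)" using wrap_cyl_adj[OF assms(1) ab(1-3)] .
    moreover have "cyl_adj n x y \<Longrightarrow> cyl_adj n y x" for x y unfolding cyl_adj_def by auto
    ultimately show "cyl_adj n u v" using ab(4) by (metis doubleton_eq_iff)
  next
    assume "cyl_adj n u v"
    then obtain a b where "a \<in> ?P" "b \<in> ?P" "grid_adj a b" "wrap n a = u" "wrap n b = v"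
      using cyl_adj_lift[OF assms] by metis
    then show "\<exists>a\<in>?P. \<exists>b\<in>?P. grid_adj a b \<and> {wrap n a, wrap n b} = {u, v}" by blast
  qed
  finally show ?thesis .
qed

lemma indep_complex_cyl_graph:
  assumes "n \<ge> 1"
  shows "indep_complex (cyl_graph m n) = ind ({1..m} \<times> {1..n}) (cyl_adj n)"
proof -
  have "verts (cyl_graph m n) = {1..m} \<times> {1..n}"
  proof -
    have "(i, j) \<in> wrap n ` ({1..m} \<times> {1..n + 1})" if "(i, j) \<in> {1..m} \<times> {1..n}" for i j
      using that by (intro image_eqI[of _ _ "(i, j)"]) (auto simp: wrap_def)
    then show ?thesis using assms
      unfolding cyl_graph_def grid_graph_def by (auto simp: wrap_def)
  qed
  moreover have "(\<exists>e\<in>edges (cyl_graph m n). ends (cyl_graph m n) e = {u, v}) \<longleftrightarrow> cyl_adj n u v"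
    if "S \<subseteq> {1..m} \<times> {1..n}" "u \<in> S" "v \<in> S" for S u v
    using cyl_graph_adj[OF assms subsetD[OF that(1,2)] subsetD[OF that(1,3)]] .
  ultimately have "indep_set (cyl_graph m n) S \<longleftrightarrow> S \<in> ind ({1..m} \<times> {1..n}) (cyl_adj n)" for S
    unfolding indep_set_def ind_iff by (simp cong: conj_cong)
  then show ?thesis unfolding indep_complex_def by (intro set_eqI) simp
qed

definition pad_adj :: "nat \<times> nat \<Rightarrow> nat \<times> nat \<Rightarrow> bool" where
  "pad_adj x y \<longleftrightarrow> fst x = 0 \<and> fst y = 0 \<and> snd x \<noteq> snd y \<and> snd x div 2 = snd y div 2"

text \<open>Row \<open>0\<close> carries \<open>s\<close> disjoint edges, each of which suspends the complex.\<close>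

definition padded :: "nat \<Rightarrow> (nat \<times> nat) set \<Rightarrow> (nat \<times> nat \<Rightarrow> nat \<times> nat \<Rightarrow> bool) \<Rightarrow> (nat \<times> nat) set set" where
  "padded s C B = ind ({0} \<times> {..<2 * s} \<union> C) (\<lambda>x y. pad_adj x y \<or> B x y)"

lemma ind_cong:
  assumes "\<And>x y. x \<in> V \<Longrightarrow> y \<in> V \<Longrightarrow> E x y \<longleftrightarrow> F x y"
  shows "ind V E = ind V F"
  using assms unfolding ind_def by (simp add: subset_iff cong: conj_cong)

lemma finite_complex_padded: "finite C \<Longrightarrow> finite_complex (padded s C B)"
  unfolding padded_def by (intro finite_complex_ind) simp

text \<open>Nothing but a renaming: the isolated edge between \<open>x\<close> and \<open>y\<close>
  takes the next free places \<open>2 * s\<close> and \<open>2 * s + 1\<close> of row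
  \<open>0\<close>.\<close>

lemma absorb_pair:
  assumes "finite C" "x \<noteq> y" "x \<notin> C" "y \<notin> C" "fst x \<ge> 1" "fst y \<ge> 1" and C: "\<And>z. z \<in> C \<Longrightarrow> fst z \<ge> 1"
    and xy: "\<And>z. B x z \<longleftrightarrow> z = y" "\<And>z. B z x \<longleftrightarrow> z = y" "\<And>z. B y z \<longleftrightarrow> z = x" "\<And>z. B z y \<longleftrightarrow> z = x"
    and B: "\<And>x y. B x y \<Longrightarrow> fst x \<ge> 1 \<and> fst y \<ge> 1"
  shows "same_simple_homotopy_type (padded s (insert x (insert y C)) B) (padded (Suc s) C B)"
  unfolding padded_def
proof (rule ind_iso)
  let ?h = "\<lambda>z. if z = (0, 2 * s) then x else if z = (0, 2 * s + 1) then y else z"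
  let ?W = "{0} \<times> {..<2 * Suc s} \<union> C"
  have xy0: "x \<noteq> (0, j)" "y \<noteq> (0, j)" for j using assms(5,6) by auto
  have C0: "(0, j) \<notin> C" for j using C by force
  have W: "?W = insert (0, 2 * s) (insert (0, 2 * s + 1) ({0} \<times> {..<2 * s} \<union> C))" by auto
  have "inj_on ?h ?W" using assms(2-4) xy0 C0 unfolding inj_on_def W by auto
  moreover have "?h ` ?W = {0} \<times> {..<2 * s} \<union> insert x (insert y C)"
    using assms(2) C0 unfolding W by (auto simp: image_iff)
  ultimately show "bij_betw ?h ?W ({0} \<times> {..<2 * s} \<union> insert x (insert y C))"
    unfolding bij_betw_def by blast
  show "finite ?W" using assms(1) by simp
  show "pad_adj a b \<or> B a b \<longleftrightarrow> pad_adj (?h a) (?h b) \<or> B (?h a) (?h b)"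
    if "a \<in> ?W" "b \<in> ?W" for a b
  proof -
    have nB: "\<not> B (0, j) z" "\<not> B z (0, j)" for j z using B[of "(0, j)" z] B[of z "(0, j)"] by auto
    have nP: "\<not> pad_adj x z" "\<not> pad_adj z x" "\<not> pad_adj y z" "\<not> pad_adj z y" for z
      using assms(5,6) unfolding pad_adj_def by auto
    have P: "\<not> pad_adj (0, 2 * s) z \<and> \<not> pad_adj z (0, 2 * s) \<and> \<not> pad_adj (0, 2 * s + 1) z \<and>
        \<not> pad_adj z (0, 2 * s + 1) \<and> z \<noteq> x \<and> z \<noteq> y"
      if "z \<in> {0} \<times> {..<2 * s} \<union> C" for z
      using that C[of z] assms(3,4) xy0 unfolding pad_adj_def by auto
    have PP: "pad_adj (0, 2 * s) (0, 2 * s + 1)" "pad_adj (0, 2 * s + 1) (0, 2 * s)"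
      "\<not> pad_adj z z" for z
      unfolding pad_adj_def by auto
    have ab: "a = (0, 2 * s) \<or> a = (0, 2 * s + 1) \<or> a \<in> {0} \<times> {..<2 * s} \<union> C"
      "b = (0, 2 * s) \<or> b = (0, 2 * s + 1) \<or> b \<in> {0} \<times> {..<2 * s} \<union> C"
      using that unfolding W by blast+
    have ne: "z \<noteq> (0, 2 * s)" "z \<noteq> (0, 2 * s + 1)" if "z \<in> {0} \<times> {..<2 * s} \<union> C" for z
      using that C0 by auto
    show ?thesis
      using ab(1)
    proof (elim disjE)
      assume a: "a = (0, 2 * s)"
      show ?thesis using ab(2)
        by (elim disjE) (use a nB nP xy PP P ne \<open>x \<noteq> y\<close> in simp_all)
    next
      assume a: "a = (0, 2 * s + 1)"
      show ?thesis using ab(2)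
        by (elim disjE) (use a nB nP xy PP P ne \<open>x \<noteq> y\<close> in simp_all)
    next
      assume a: "a \<in> {0} \<times> {..<2 * s} \<union> C"
      show ?thesis using ab(2)
        by (elim disjE) (use P[OF a] ne[OF a] nB nP xy PP P ne \<open>x \<noteq> y\<close> in simp_all)
    qed
  qed
qed

lemma absorb_pairs:
  assumes "finite C" "distinct (map fst prs @ map snd prs)" "set (map fst prs @ map snd prs) \<inter> C = {}"
    and "\<And>z. z \<in> set (map fst prs @ map snd prs) \<union> C \<Longrightarrow> fst z \<ge> 1"
    and "\<And>x y z. (x, y) \<in> set prs \<Longrightarrow> (B x z \<longleftrightarrow> z = y) \<and> (B y z \<longleftrightarrow> z = x)"
    and sym: "symp B" and B: "\<And>x y. B x y \<Longrightarrow> fst x \<ge> 1"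
  shows "same_simple_homotopy_type (padded s (set (map fst prs @ map snd prs) \<union> C) B)
    (padded (s + length prs) C B)"
  using assms(2-5)
proof (induction prs arbitrary: s)
  case Nil
  then show ?case using same_simple_homotopy_type_refl[OF finite_complex_padded[OF assms(1)]] by simp
next
  case (Cons p prs)
  obtain x y where p: "p = (x, y)" by (cases p)
  let ?D = "set (map fst prs @ map snd prs) \<union> C"
  have sym': "B a b \<longleftrightarrow> B b a" for a b using sym by (meson sympD)
  have xz: "B x z \<longleftrightarrow> z = y" "B y z \<longleftrightarrow> z = x" for z using Cons.prems(4) p by simp_all
  have "same_simple_homotopy_type (padded s (insert x (insert y ?D)) B) (padded (Suc s) ?D B)"
  proof (rule absorb_pair)
    show "finite ?D" using assms(1) by simp
    show "x \<noteq> y" "x \<notin> ?D" "y \<notin> ?D" using Cons.prems(1,2) p by auto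
    show "fst x \<ge> 1" "fst y \<ge> 1" using Cons.prems(3) p by simp_all
    show "fst z \<ge> 1" if "z \<in> ?D" for z using Cons.prems(3)[of z] that by auto
    show "B x z \<longleftrightarrow> z = y" "B z x \<longleftrightarrow> z = y" "B y z \<longleftrightarrow> z = x" "B z y \<longleftrightarrow> z = x" for z
      using xz sym' by metis+
    show "fst a \<ge> 1 \<and> fst b \<ge> 1" if "B a b" for a b using B that sym' by blast
  qed
  moreover have "same_simple_homotopy_type (padded (Suc s) ?D B) (padded (Suc s + length prs) C B)"
  proof (rule Cons.IH)
    show "(B a z \<longleftrightarrow> z = b) \<and> (B b z \<longleftrightarrow> z = a)" if "(a, b) \<in> set prs" for a b z
      using Cons.prems(4) that by simp
    show "fst z \<ge> 1" if "z \<in> ?D" for z using Cons.prems(3)[of z] that by auto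
  qed (use Cons.prems(1,2) in auto)
  moreover have "set (map fst (p # prs) @ map snd (p # prs)) \<union> C = insert x (insert y ?D)"
    using p by auto
  ultimately show ?case using same_simple_homotopy_type_trans by simp
qed

lemma padded_iso:
  assumes g: "bij_betw g W C" and "finite W"
    and W: "\<And>x. x \<in> W \<Longrightarrow> fst x \<ge> 1" and C: "\<And>x. x \<in> C \<Longrightarrow> fst x \<ge> 1"
    and "\<And>x y. x \<in> W \<Longrightarrow> y \<in> W \<Longrightarrow> F x y \<longleftrightarrow> B (g x) (g y)"
    and F: "\<And>x y. F x y \<Longrightarrow> fst x \<ge> 1 \<and> fst y \<ge> 1" and B: "\<And>x y. B x y \<Longrightarrow> fst x \<ge> 1 \<and> fst y \<ge> 1"
  shows "same_simple_homotopy_type (padded s C B) (padded s W F)"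
  unfolding padded_def
proof (rule ind_iso)
  let ?h = "\<lambda>z. if fst z = 0 then z else g z" and ?P = "{0::nat} \<times> {..<2 * s}"
  have 1: "?h z = z" if "z \<in> ?P" for z using that by auto
  have 2: "?h z = g z" if "z \<in> W" for z using W[OF that] by auto
  have "bij_betw ?h ?P ?P \<longleftrightarrow> bij_betw id ?P ?P" by (rule bij_betw_cong) (simp add: 1)
  then have "bij_betw ?h ?P ?P" by simp
  moreover have "bij_betw ?h W C \<longleftrightarrow> bij_betw g W C" by (rule bij_betw_cong) (rule 2)
  then have "bij_betw ?h W C" using g by simp
  moreover have "?P \<inter> C = {}" using C by force
  ultimately show "bij_betw ?h (?P \<union> W) (?P \<union> C)" by (rule bij_betw_combine)
  show "finite (?P \<union> W)" using assms(2) by simp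
  have gW: "fst (g z) \<ge> 1" if "z \<in> W" for z using C bij_betw_imp_surj_on[OF g] that by blast
  show "pad_adj a b \<or> F a b \<longleftrightarrow> pad_adj (?h a) (?h b) \<or> B (?h a) (?h b)"
    if "a \<in> ?P \<union> W" "b \<in> ?P \<union> W" for a b
  proof -
    consider "a \<in> ?P" "b \<in> ?P" | "a \<in> ?P" "b \<in> W" | "a \<in> W" "b \<in> ?P" | "a \<in> W" "b \<in> W"
      using \<open>a \<in> _\<close> \<open>b \<in> _\<close> by blast
    then show ?thesis
    proof cases
      case 1
      then show ?thesis using F[of a b] B[of a b] by auto
    next
      case 2
      then show ?thesis using F[of a b] B[of a "g b"] W[of b] gW[of b] by (auto simp: pad_adj_def)
    next
      case 3
      then show ?thesis using F[of a b] B[of "g a" b] W[of a] gW[of a] by (auto simp: pad_adj_def)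
    next
      case 4
      then show ?thesis using assms(5)[of a b] W[of a] W[of b] gW[of a] gW[of b] by (auto simp: pad_adj_def)
    qed
  qed
qed

section \<open>Reduction of cylindrical grids\<close>

definition graph_nbrs :: "'a list \<Rightarrow> ('a \<Rightarrow> 'a \<Rightarrow> bool) \<Rightarrow> 'a nbrs" where
  "graph_nbrs vs E = map (\<lambda>x. (x, filter (E x) vs)) vs"

lemma map_of_graph_nbrs:
  "map_of (graph_nbrs vs E) x = (if x \<in> set vs then Some (filter (E x) vs) else None)"
proof -
  have "map_of (map (\<lambda>x. (x, f x)) ws) x = (if x \<in> set ws then Some (f x) else None)"
    for f :: "'a \<Rightarrow> 'a list" and ws
    by (induction ws) auto
  then show ?thesis unfolding graph_nbrs_def .
qed

lemma is_key_graph_nbrs [simp]: "is_key (graph_nbrs vs E) x \<longleftrightarrow> x \<in> set vs"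
  unfolding is_key_def map_of_graph_nbrs by simp

lemma adj_graph_nbrs: "adj (graph_nbrs vs E) x y \<longleftrightarrow> x \<in> set vs \<and> y \<in> set vs \<and> E x y"
  unfolding nbr_def map_of_graph_nbrs by (cases "x \<in> set vs") auto

lemma is_key_iff: "is_key A x \<longleftrightarrow> x \<in> set (map fst A)"
  unfolding is_key_def by (simp add: map_of_eq_None_iff)

definition rect :: "nat \<Rightarrow> nat \<Rightarrow> (nat \<times> nat) list" where
  "rect m n = List.product [1..<m + 1] [1..<n + 1]"

lemma set_rect: "set (rect m n) = {1..m} \<times> {1..n}"
  unfolding rect_def by auto

text \<open>The pairs \<open>prs\<close> are isolated edges, ready to be moved to row \<open>0\<close>, and \<open>ys\<close> are the other
  vertices that are left.\<close>

definition reduces_to :: "(nat \<times> nat \<Rightarrow> bool) \<Rightarrow> (nat \<times> nat) nbrs option \<Rightarrow>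
    ((nat \<times> nat) \<times> (nat \<times> nat)) list \<Rightarrow> (nat \<times> nat) list \<Rightarrow> (nat \<times> nat \<Rightarrow> nat \<times> nat \<Rightarrow> bool) \<Rightarrow> bool" where
  "reduces_to cl r prs ys E \<longleftrightarrow> (case r of None \<Rightarrow> False | Some A \<Rightarrow>
     set (map fst A) = set (map fst prs @ map snd prs @ ys) \<and>
     distinct (map fst prs @ map snd prs @ ys) \<and>
     (\<forall>x\<in>set (map fst prs @ map snd prs). cl x) \<and>
     (\<forall>x\<in>set (map fst prs @ map snd prs @ ys). fst x \<ge> 1) \<and>
     (\<forall>(x, y)\<in>set prs. nbr A x = [y] \<and> nbr A y = [x]) \<and>
     (\<forall>x\<in>set ys. \<forall>y\<in>set ys. adj A x y \<longleftrightarrow> E x y))"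

lemma reduces_toE:
  assumes "reduces_to cl r prs ys E"
  obtains A where "r = Some A" "\<forall>x. is_key A x \<longleftrightarrow> x \<in> set (map fst prs @ map snd prs @ ys)"
    "distinct (map fst prs @ map snd prs @ ys)"
    "\<forall>x. x \<in> set (map fst prs @ map snd prs) \<longrightarrow> cl x"
    "\<forall>x. x \<in> set (map fst prs @ map snd prs @ ys) \<longrightarrow> fst x \<ge> 1"
    "\<forall>x y z. (x, y) \<in> set prs \<longrightarrow> (adj A x z \<longleftrightarrow> z = y) \<and> (adj A y z \<longleftrightarrow> z = x)"
    "\<forall>x y. x \<in> set ys \<longrightarrow> y \<in> set ys \<longrightarrow> adj A x y \<longleftrightarrow> E x y"
proof (cases r)
  case None
  then show ?thesis using assms unfolding reduces_to_def by simp
next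
  case (Some A)
  have A: "set (map fst A) = set (map fst prs @ map snd prs @ ys)"
    "distinct (map fst prs @ map snd prs @ ys)"
    "\<forall>x\<in>set (map fst prs @ map snd prs). cl x"
    "\<forall>x\<in>set (map fst prs @ map snd prs @ ys). fst x \<ge> 1"
    "\<forall>(x, y)\<in>set prs. nbr A x = [y] \<and> nbr A y = [x]"
    "\<forall>x\<in>set ys. \<forall>y\<in>set ys. adj A x y \<longleftrightarrow> E x y"
    using assms unfolding reduces_to_def Some option.case by blast+
  show ?thesis
  proof (rule that[OF Some])
    show "\<forall>x. is_key A x \<longleftrightarrow> x \<in> set (map fst prs @ map snd prs @ ys)"
      unfolding is_key_iff A(1) by blast
    show "\<forall>x y z. (x, y) \<in> set prs \<longrightarrow> (adj A x z \<longleftrightarrow> z = y) \<and> (adj A y z \<longleftrightarrow> z = x)"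
      using A(5) by auto
  qed (use A(2-4,6) in blast)+
qed

definition clique_adj :: "nat \<times> nat \<Rightarrow> nat \<times> nat \<Rightarrow> bool" where
  "clique_adj x y \<longleftrightarrow> fst x \<ge> 1 \<and> fst y \<ge> 1 \<and> x \<noteq> y"

text \<open>Here the window is the entire graph: every vertex outside row \<open>0\<close> is
  closed, and row \<open>0\<close> forms the surroundings. The moves therefore work for every
  \<open>s\<close>.\<close>

lemma reduce_whole:
  assumes red: "reduces_to (\<lambda>x. fst x \<ge> 1) (do_moves (\<lambda>x. fst x \<ge> 1) ms (graph_nbrs vs E)) prs ys (\<noteq>)"
    and "symp E" and E: "\<And>x y. E x y \<Longrightarrow> fst x \<ge> 1 \<and> fst y \<ge> 1" and vs: "\<And>x. x \<in> set vs \<Longrightarrow> fst x \<ge> 1"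
  shows "same_simple_homotopy_type (padded s (set vs) E)
    (padded (s + length prs) ({1} \<times> {..<length ys}) clique_adj)"
proof -
  interpret graph_window "\<lambda>x. fst x \<ge> 1" "{0} \<times> {..<2 * s}" pad_adj
    by unfold_locales (auto simp: pad_adj_def)
  let ?A0 = "graph_nbrs vs E" and ?P = "set (map fst prs @ map snd prs)"
  obtain A where A': "do_moves (\<lambda>x. fst x \<ge> 1) ms ?A0 = Some A"
    "\<forall>x. is_key A x \<longleftrightarrow> x \<in> set (map fst prs @ map snd prs @ ys)"
    "distinct (map fst prs @ map snd prs @ ys)"
    "\<forall>x. x \<in> ?P \<longrightarrow> fst x \<ge> 1"
    "\<forall>x. x \<in> set (map fst prs @ map snd prs @ ys) \<longrightarrow> fst x \<ge> 1"
    "\<forall>x y z. (x, y) \<in> set prs \<longrightarrow> (adj A x z \<longleftrightarrow> z = y) \<and> (adj A y z \<longleftrightarrow> z = x)"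
    "\<forall>x y. x \<in> set ys \<longrightarrow> y \<in> set ys \<longrightarrow> adj A x y \<longleftrightarrow> x \<noteq> y"
    using red by (rule reduces_toE)
  note A = A'[rule_format]
  have "symp (adj ?A0)" using \<open>symp E\<close> unfolding symp_def adj_graph_nbrs by blast
  then have sym: "symp (adj A)" and sht: "same_simple_homotopy_type (whole ?A0) (whole A)"
    using do_moves_sound[OF A(1)] by blast+
  have adj1: "fst x \<ge> 1 \<and> fst y \<ge> 1" if "adj A x y" for x y
    using that sym A(2,5) adj_is_key by (metis sympD)
  have vs': "closed_verts (\<lambda>x. fst x \<ge> 1) ?A0 = set vs" using vs unfolding closed_verts_def by auto
  have w0: "whole ?A0 = padded s (set vs) E"
    unfolding whole_def padded_def adj_graph_nbrs vs'
  proof (rule ind_cong)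
    show "pad_adj x y \<or> x \<in> set vs \<and> y \<in> set vs \<and> E x y \<longleftrightarrow> pad_adj x y \<or> E x y"
      if "x \<in> {0} \<times> {..<2 * s} \<union> set vs" "y \<in> {0} \<times> {..<2 * s} \<union> set vs" for x y
      using that E[of x y] by auto
  qed
  have "closed_verts (\<lambda>x. fst x \<ge> 1) A = ?P \<union> set ys"
    using A(5) unfolding closed_verts_def A(2) set_append by blast
  then have w1: "whole A = padded s (?P \<union> set ys) (adj A)" unfolding whole_def padded_def by simp
  have absorb: "same_simple_homotopy_type (padded s (?P \<union> set ys) (adj A)) (padded (s + length prs) (set ys) (adj A))"
  proof (rule absorb_pairs)
    show "set (map fst prs @ map snd prs) \<inter> set ys = {}" using A(3) by auto
    show "fst z \<ge> 1" if "z \<in> ?P \<union> set ys" for z using A(5)[of z] that by auto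
  qed (use A(3,6) sym adj1 in auto)
  have iso: "same_simple_homotopy_type (padded (s + length prs) (set ys) (adj A))
      (padded (s + length prs) ({1} \<times> {..<length ys}) clique_adj)"
  proof (rule padded_iso)
    have dist: "distinct ys" using A(3) by simp
    have "bij_betw snd ({1} \<times> {..<length ys}) {..<length ys}"
      by (rule bij_betw_byWitness[where f' = "Pair 1"]) auto
    then show "bij_betw ((!) ys \<circ> snd) ({1} \<times> {..<length ys}) (set ys)"
      using bij_betw_nth[OF dist refl refl] by (rule bij_betw_trans)
    show "clique_adj x y \<longleftrightarrow> adj A (((!) ys \<circ> snd) x) (((!) ys \<circ> snd) y)"
      if "x \<in> {1} \<times> {..<length ys}" "y \<in> {1} \<times> {..<length ys}" for x y
    proof -
      have *: "snd x < length ys" "snd y < length ys" "fst x = 1" "fst y = 1" using that by auto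
      then have "x = y \<longleftrightarrow> ys ! snd x = ys ! snd y"
        using nth_eq_iff_index_eq[OF dist] prod_eq_iff[of x y] by metis
      then show ?thesis using A(7)[of "ys ! snd x" "ys ! snd y"] * by (simp add: clique_adj_def)
    qed
    show "fst x \<ge> 1" if "x \<in> set ys" for x using A(5) that by simp
    show "fst x \<ge> 1 \<and> fst y \<ge> 1" if "adj A x y" for x y using adj1[OF that] .
  qed (simp_all add: clique_adj_def mem_Times_iff)
  show ?thesis
    using same_simple_homotopy_type_trans[OF sht[unfolded w0 w1] same_simple_homotopy_type_trans[OF absorb iso]] .
qed

abbreviation cyl :: "nat \<Rightarrow> nat \<Rightarrow> nat \<Rightarrow> (nat \<times> nat) set set" where
  "cyl m n s \<equiv> padded s ({1..m} \<times> {1..n}) (cyl_adj n)"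

text \<open>The clique yields \<open>q\<close> isolated points, which the \<open>s\<close> edges of
  row \<open>0\<close> suspend \<open>s\<close> times. For \<open>q = 0\<close> only the join of
  \<open>s\<close> pairs remains, a sphere of dimension \<open>s - 1\<close>.\<close>

abbreviation suspended_points :: "nat \<Rightarrow> nat \<Rightarrow> (nat \<times> nat) set set" where
  "suspended_points q s \<equiv> padded s ({1} \<times> {..<q}) clique_adj"

lemma symp_cyl_adj: "symp (cyl_adj n)"
  unfolding symp_def cyl_adj_def by auto

lemma cyl_adj_pos: "cyl_adj n x y \<Longrightarrow> fst x \<ge> 1 \<and> fst y \<ge> 1"
  unfolding cyl_adj_def by auto

lemma reduce_cyl:
  assumes red: "reduces_to (\<lambda>x. fst x \<ge> 1)
      (do_moves (\<lambda>x. fst x \<ge> 1) ms (graph_nbrs (rect m n) (cyl_adj n))) prs ys (\<noteq>)"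
    and "length prs = t" "length ys = q"
  shows "same_simple_homotopy_type (cyl m n s) (suspended_points q (s + t))"
proof -
  have "fst x \<ge> 1" if "x \<in> set (rect m n)" for x using that unfolding set_rect by auto
  then show ?thesis
    using reduce_whole[OF red symp_cyl_adj cyl_adj_pos, where s = s] assms(2,3) unfolding set_rect by simp
qed

definition inner_column :: "nat \<Rightarrow> nat \<times> nat \<Rightarrow> bool" where
  "inner_column p x \<longleftrightarrow> fst x \<ge> 1 \<and> 2 \<le> snd x \<and> snd x \<le> p + 1"

definition outer_columns :: "nat \<Rightarrow> nat \<Rightarrow> (nat \<times> nat) list" where
  "outer_columns m p = List.product [1..<m + 1] [1, p + 2]"

text \<open>The graph that the moves must leave on the outer columns: the vertical edges, which the
  window lists from the start, and the new edges across.\<close>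

definition shortcut_adj :: "nat \<times> nat \<Rightarrow> nat \<times> nat \<Rightarrow> bool" where
  "shortcut_adj x y \<longleftrightarrow> snd x = snd y \<and> (fst x = fst y + 1 \<or> fst y = fst x + 1) \<or> fst x = fst y \<and> snd x \<noteq> snd y"

text \<open>As \<open>n \<ge> 2\<close>, the wrap-around edges join columns \<open>1\<close> and
  \<open>n + p\<close>, neither of which is inner, so each edge at an inner vertex is a grid edge of
  the window. Edges between outer vertices may satisfy both alternatives.\<close>

lemma cyl_adj_window:
  assumes "n \<ge> 2" "x \<in> {1..m} \<times> {1..n + p}" "y \<in> {1..m} \<times> {1..n + p}"
  shows "cyl_adj (n + p) x y \<longleftrightarrow> cyl_adj (n + p) x y \<and> \<not> inner_column p x \<and> \<not> inner_column p y \<or>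
    x \<in> {1..m} \<times> {1..p + 2} \<and> y \<in> {1..m} \<times> {1..p + 2} \<and> grid_adj x y"
proof -
  obtain i j i' j' where xy: "x = (i, j)" "y = (i', j')" by (cases x, cases y)
  have ij: "1 \<le> i" "i \<le> m" "1 \<le> j" "j \<le> n + p" "1 \<le> i'" "i' \<le> m" "1 \<le> j'" "j' \<le> n + p"
    using assms(2,3) xy by auto
  have "cyl_adj (n + p) x y" if "grid_adj x y"
    using that ij unfolding cyl_adj_def grid_adj_def xy by auto
  moreover have "j' \<le> p + 2 \<and> j \<le> p + 2 \<and> grid_adj x y"
    if "cyl_adj (n + p) x y" "inner_column p x \<or> inner_column p y"
    using that ij \<open>n \<ge> 2\<close> unfolding cyl_adj_def grid_adj_def inner_column_def xy fst_conv snd_conv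
    by arith
  ultimately show ?thesis using ij xy by auto
qed

text \<open>The edges of the short cylinder between columns 1 and 2 come from the shortcut, and its
  wrap-around edges are those of the long one. For \<open>n = 2\<close> the two kinds
  coincide.\<close>

lemma cyl_adj_shorten:
  assumes "n \<ge> 2" "1 \<le> i" "1 \<le> i'" "1 \<le> j" "j \<le> n" "1 \<le> j'" "j' \<le> n"
    and k: "k = (if j = 1 then 1 else j + p)" "k' = (if j' = 1 then 1 else j' + p)"
  shows "cyl_adj n (i, j) (i', j') \<longleftrightarrow> cyl_adj (n + p) (i, k) (i', k') \<or>
    (k = 1 \<or> k = p + 2) \<and> (k' = 1 \<or> k' = p + 2) \<and> shortcut_adj (i, k) (i', k')"
proof (cases "j = 1"; cases "j' = 1")
  assume "j = 1" "j' = 1"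
  then show ?thesis using assms unfolding cyl_adj_def shortcut_adj_def by auto
next
  assume "j = 1" "j' \<noteq> 1"
  then show ?thesis using assms unfolding cyl_adj_def shortcut_adj_def by auto
next
  assume "j \<noteq> 1" "j' = 1"
  then show ?thesis using assms unfolding cyl_adj_def shortcut_adj_def by auto
next
  assume "j \<noteq> 1" "j' \<noteq> 1"
  then show ?thesis using assms unfolding cyl_adj_def shortcut_adj_def by auto
qed

lemma grid_adj_commute: "grid_adj x y \<longleftrightarrow> grid_adj y x"
  unfolding grid_adj_def by auto

text \<open>Row \<open>0\<close> and the columns \<open>1\<close>, \<open>p + 2\<close>, ...,
  \<open>n + p\<close> are the surroundings, so the certificate involves neither \<open>n\<close>
  nor \<open>s\<close>. Afterwards the isolated edges move to row \<open>0\<close> and the remaining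
  columns are renumbered.\<close>

lemma shorten_cyl:
  assumes red: "reduces_to (inner_column p)
      (do_moves (inner_column p) ms (graph_nbrs (rect m (p + 2)) grid_adj)) prs (outer_columns m p) shortcut_adj"
    and "length prs = t" and "n \<ge> 2"
  shows "same_simple_homotopy_type (cyl m (n + p) s) (cyl m n (s + t))"
proof -
  let ?O = "{1..m} \<times> insert 1 {p + 2..n + p}"
  let ?R = "\<lambda>x y. cyl_adj (n + p) x y \<and> \<not> inner_column p x \<and> \<not> inner_column p y"
  interpret graph_window "inner_column p" "{0} \<times> {..<2 * s} \<union> ?O" "\<lambda>x y. pad_adj x y \<or> ?R x y"
    by unfold_locales (auto simp: pad_adj_def inner_column_def)
  let ?A0 = "graph_nbrs (rect m (p + 2)) grid_adj" and ?P = "set (map fst prs @ map snd prs)"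
  obtain A where A': "do_moves (inner_column p) ms ?A0 = Some A"
    "\<forall>x. is_key A x \<longleftrightarrow> x \<in> set (map fst prs @ map snd prs @ outer_columns m p)"
    "distinct (map fst prs @ map snd prs @ outer_columns m p)"
    "\<forall>x. x \<in> ?P \<longrightarrow> inner_column p x"
    "\<forall>x. x \<in> set (map fst prs @ map snd prs @ outer_columns m p) \<longrightarrow> fst x \<ge> 1"
    "\<forall>x y z. (x, y) \<in> set prs \<longrightarrow> (adj A x z \<longleftrightarrow> z = y) \<and> (adj A y z \<longleftrightarrow> z = x)"
    "\<forall>x y. x \<in> set (outer_columns m p) \<longrightarrow> y \<in> set (outer_columns m p) \<longrightarrow> adj A x y \<longleftrightarrow> shortcut_adj x y"
    using red by (rule reduces_toE)
  note A = A'[rule_format]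
  have "symp (adj ?A0)" unfolding symp_def adj_graph_nbrs using grid_adj_commute by blast
  then have sym: "symp (adj A)" and sht: "same_simple_homotopy_type (whole ?A0) (whole A)"
    using do_moves_sound[OF A(1)] by blast+
  have outer: "set (outer_columns m p) = {1..m} \<times> {1, p + 2}" unfolding outer_columns_def by auto
  have not_inner: "\<not> inner_column p x" if "x \<in> ?O" for x using that unfolding inner_column_def by auto
  have adj1: "fst x \<ge> 1 \<and> fst y \<ge> 1" if "adj A x y" for x y
    using that sym A(2,5) adj_is_key by (metis sympD)
  let ?B = "\<lambda>x y. ?R x y \<or> adj A x y"
  have B1: "fst x \<ge> 1 \<and> fst y \<ge> 1" if "?B x y" for x y using that adj1 cyl_adj_pos by blast
  have "closed_verts (inner_column p) ?A0 = {1..m} \<times> {2..p + 1}"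
    unfolding closed_verts_def is_key_graph_nbrs set_rect inner_column_def by auto
  moreover have "?O \<union> {1..m} \<times> {2..p + 1} = {1..m} \<times> {1..n + p}" using \<open>n \<ge> 2\<close> by auto
  ultimately have V0: "{0} \<times> {..<2 * s} \<union> ?O \<union> closed_verts (inner_column p) ?A0 =
      {0} \<times> {..<2 * s} \<union> {1..m} \<times> {1..n + p}"
    by (simp only: Un_assoc)
  have w0: "whole ?A0 = cyl m (n + p) s"
    unfolding whole_def padded_def V0
  proof (rule ind_cong)
    fix x y assume xy: "x \<in> {0} \<times> {..<2 * s} \<union> {1..m} \<times> {1..n + p}"
      "y \<in> {0} \<times> {..<2 * s} \<union> {1..m} \<times> {1..n + p}"
    have "?R x y \<or> adj ?A0 x y \<longleftrightarrow> cyl_adj (n + p) x y"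
    proof (cases "x \<in> {1..m} \<times> {1..n + p} \<and> y \<in> {1..m} \<times> {1..n + p}")
      case True
      then show ?thesis
        unfolding adj_graph_nbrs set_rect using cyl_adj_window[OF \<open>n \<ge> 2\<close>, of x m p y] by blast
    next
      case False
      then have "fst x = 0 \<or> fst y = 0" using xy by auto
      then show ?thesis
        using cyl_adj_pos[of "n + p" x y] unfolding adj_graph_nbrs set_rect by (auto simp: mem_Times_iff)
    qed
    then show "(pad_adj x y \<or> ?R x y) \<or> adj ?A0 x y \<longleftrightarrow> pad_adj x y \<or> cyl_adj (n + p) x y" by blast
  qed
  have "closed_verts (inner_column p) A = ?P"
  proof -
    have "\<not> inner_column p x" if "x \<in> set (outer_columns m p)" for x
      using that unfolding outer inner_column_def by auto
    then show ?thesis using A(4) unfolding closed_verts_def A(2) set_append by blast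
  qed
  then have w1: "whole A = padded s (?P \<union> ?O) ?B"
    unfolding whole_def padded_def by (simp only: Un_ac disj_ac)
  have absorb: "same_simple_homotopy_type (padded s (?P \<union> ?O) ?B) (padded (s + length prs) ?O ?B)"
  proof (rule absorb_pairs)
    show "distinct (map fst prs @ map snd prs)"
      using A(3) by (auto simp only: append_assoc[symmetric] distinct_append)
    show "?P \<inter> ?O = {}" using A(4) not_inner by blast
    show "fst z \<ge> 1" if "z \<in> ?P \<union> ?O" for z using A(5)[of z] that by auto
    show "(?B x z \<longleftrightarrow> z = y) \<and> (?B y z \<longleftrightarrow> z = x)" if "(x, y) \<in> set prs" for x y z
    proof -
      have "x \<in> ?P" "y \<in> ?P" using that by force+
      then show ?thesis using A(4,6) that by blast
    qed
    show "symp ?B" using sym symp_cyl_adj unfolding symp_def by blast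
  qed (use B1 in auto)
  have iso: "same_simple_homotopy_type (padded (s + length prs) ?O ?B) (cyl m n (s + length prs))"
  proof (rule padded_iso)
    let ?g = "\<lambda>(i, j). (i, if j = 1 then 1 else j + p)"
    show "bij_betw ?g ({1..m} \<times> {1..n}) ?O"
    proof -
      have "inj_on ?g ({1..m} \<times> {1..n})" unfolding inj_on_def by (auto split: if_splits)
      moreover have "z \<in> ?g ` ({1..m} \<times> {1..n})" if z: "z \<in> ?O" for z
      proof (cases "snd z = 1")
        case True
        then show ?thesis using z \<open>n \<ge> 2\<close> by (intro image_eqI[of _ _ "(fst z, 1)"]) auto
      next
        case False
        then show ?thesis using z by (intro image_eqI[of _ _ "(fst z, snd z - p)"]) auto
      qed
      ultimately show ?thesis using \<open>n \<ge> 2\<close> unfolding bij_betw_def by (auto split: if_splits)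
    qed
    show "cyl_adj n x y \<longleftrightarrow> ?B (?g x) (?g y)"
      if "x \<in> {1..m} \<times> {1..n}" "y \<in> {1..m} \<times> {1..n}" for x y
    proof -
      obtain i j i' j' where eq: "x = (i, j)" "y = (i', j')" by (cases x, cases y)
      define k k' where k: "k = (if j = 1 then 1 else j + p)" "k' = (if j' = 1 then 1 else j' + p)"
      have ij: "1 \<le> i" "1 \<le> i'" "1 \<le> j" "j \<le> n" "1 \<le> j'" "j' \<le> n" "i \<le> m" "i' \<le> m"
        using that eq by auto
      have g: "?g x = (i, k)" "?g y = (i', k')" using k eq by auto
      have O: "(i, k) \<in> ?O" "(i', k') \<in> ?O" using ij k by auto
      \<comment> \<open>All other keys left in the window are ends of isolated edges, and these are
        inner vertices.\<close>
      have key: "z \<in> set (outer_columns m p)" if "z \<in> ?O" "is_key A z" for z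
        using that A(2,4) not_inner set_append Un_iff by metis
      have "adj A (i, k) (i', k') \<longleftrightarrow> (i, k) \<in> set (outer_columns m p) \<and>
          (i', k') \<in> set (outer_columns m p) \<and> shortcut_adj (i, k) (i', k')"
      proof
        assume *: "adj A (i, k) (i', k')"
        have "(i, k) \<in> set (outer_columns m p)" using key[OF O(1) adj_is_key[OF *]] .
        moreover have "(i', k') \<in> set (outer_columns m p)"
          using key[OF O(2) adj_is_key[OF sympD[OF sym *]]] .
        ultimately show "(i, k) \<in> set (outer_columns m p) \<and>
          (i', k') \<in> set (outer_columns m p) \<and> shortcut_adj (i, k) (i', k')"
          using A(7) * by simp
      qed (use A(7) in simp)
      then have "adj A (i, k) (i', k') \<longleftrightarrow>
          (k = 1 \<or> k = p + 2) \<and> (k' = 1 \<or> k' = p + 2) \<and> shortcut_adj (i, k) (i', k')"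
        unfolding outer using ij by auto
      then show ?thesis
        using cyl_adj_shorten[OF \<open>n \<ge> 2\<close> ij(1-6) k] not_inner O unfolding eq g[unfolded eq] by blast
    qed
  qed (use B1 cyl_adj_pos in auto)
  show ?thesis
    using same_simple_homotopy_type_trans[OF sht[unfolded w0 w1] same_simple_homotopy_type_trans[OF absorb iso]]
    unfolding \<open>length prs = t\<close> .
qed

text \<open>The lists of moves were found by a computer search.\<close>

definition window_2_moves :: "(nat \<times> nat) move list" where
  "window_2_moves =
    [Add (1,1) (1,6) [((2,2),(2,4))] (2,5),
     Rem (1,1) (1,2) [((2,3),(2,5)), ((2,3),(1,4))] (1,5),
     Rem (1,5) (1,6) [((1,2),(2,3))] (2,4),
     Add (2,1) (2,6) [((1,2),(2,3)), ((1,2),(1,4))] (2,4),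
     Rem (2,1) (2,2) [((1,3),(2,4)), ((1,3),(1,5))] (2,5),
     Rem (2,5) (2,6) [((2,2),(1,3))] (1,4),
     Del (2,3) [] (1,2),
     Del (2,4) [] (1,5),
     Del (1,3) [] (2,2),
     Del (1,4) [] (2,5)]"

text \<open>Three moves per row add the edge from \<open>(i,1)\<close> to \<open>(i,6)\<close> and
  cut the edges from these ends to columns 2 and 5. Four deletions then take the detached 2 by 4
  grid to two disjoint edges.\<close>

lemma shorten_cyl_2:
  "n \<ge> 2 \<Longrightarrow> same_simple_homotopy_type (cyl 2 (n + 4) s) (cyl 2 n (s + 2))"
  by (rule shorten_cyl[of _ window_2_moves _
      "[((1,2),(2,2)), ((1,5),(2,5))]"];
      (assumption | code_simp))

definition window_3_moves :: "(nat \<times> nat) move list" where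
  "window_3_moves =
    [Add (1,1) (1,10) [((2,2),(3,3)), ((1,3),(2,4)), ((3,4),(2,5)), ((3,4),(3,6)),
       ((2,6),(1,7)), ((3,7),(2,8))] (1,8),
     Rem (1,1) (1,2) [((2,3),(3,4)), ((1,4),(2,5)), ((3,5),(3,7)), ((3,5),(2,6)), ((2,7),(1,8)),
       ((3,8),(2,9))] (1,9),
     Rem (1,9) (1,10) [((1,2),(2,3)), ((1,7),(2,6)), ((2,8),(3,7)), ((3,6),(2,5)),
       ((3,6),(3,4)), ((3,3),(2,2)), ((1,2),(1,4))] (2,4),
     Add (2,1) (2,10) [((1,2),(2,3)), ((1,2),(1,4)), ((3,2),(3,4)), ((2,4),(2,6)),
       ((2,4),(1,5)), ((1,6),(1,8))] (1,9),
     Rem (2,1) (2,2) [((1,3),(2,4)), ((1,3),(1,5)), ((3,3),(3,5)), ((2,5),(1,6)), ((2,5),(2,7)),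
       ((2,5),(3,6)), ((1,7),(1,9)), ((1,7),(2,8)), ((3,7),(3,9))] (2,9),
     Rem (2,9) (2,10) [((1,8),(1,6)), ((1,5),(2,4)), ((1,8),(2,7)), ((2,6),(3,5)),
       ((3,4),(3,2)), ((2,2),(1,3)), ((1,4),(2,5)), ((2,6),(3,7))] (3,8),
     Add (3,1) (3,10) [((2,2),(1,3)), ((3,3),(2,4)), ((1,4),(1,6)), ((1,4),(2,5)),
       ((2,6),(3,7)), ((1,7),(2,8))] (3,8),
     Rem (3,1) (3,2) [((1,2),(2,3)), ((1,2),(1,4)), ((2,4),(3,5)), ((3,4),(2,5)), ((1,5),(1,7)),
       ((1,5),(2,6)), ((3,6),(3,8)), ((1,8),(2,9))] (3,9),
     Rem (3,9) (3,10) [((1,2),(2,3)), ((3,7),(2,6)), ((2,8),(1,7)), ((1,6),(2,5)),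
       ((1,6),(1,4)), ((1,3),(2,2)), ((3,2),(3,4))] (2,4),
     Del (1,5) [((1,2),(2,3)), ((1,3),(2,2)), ((3,2),(3,4))] (2,4),
     Del (1,7) [((2,6),(3,5)), ((2,8),(3,9)), ((1,9),(2,8)), ((3,8),(3,6)), ((2,6),(2,4)),
       ((1,4),(1,2)), ((2,2),(3,3))] (3,4),
     Del (2,7) [] (1,6),
     Del (2,4) [((3,5),(2,6))] (1,6),
     Del (2,9) [] (1,8),
     Del (1,2) [] (1,4),
     Del (2,3) [] (3,2),
     Del (3,6) [] (2,5),
     Del (2,5) [] (1,6),
     Del (2,8) [] (3,7),
     Del (3,9) [] (3,7),
     Del (3,3) [] (2,2)]"

text \<open>Nine moves rewire the three rows in the same pattern. Twelve deletions then leave 12 of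
  the 24 vertices of the detached 3 by 8 grid, in six disjoint edges.\<close>

lemma shorten_cyl_3:
  "n \<ge> 2 \<Longrightarrow> same_simple_homotopy_type (cyl 3 (n + 8) s) (cyl 3 n (s + 6))"
  by (rule shorten_cyl[of _ window_3_moves _
      "[((1,3),(1,4)), ((1,6),(2,6)), ((1,8),(1,9)), ((2,2),(3,2)), ((3,4),(3,5)), ((3,7),(3,8))]"];
      (assumption | code_simp))

section \<open>Base cases with two rows: 2 to 5 columns\<close>

definition cyl_2_2_moves :: "(nat \<times> nat) move list" where
  "cyl_2_2_moves =
    [Del (2,1) [] (1,2),
     Del (1,1) [] (2,2)]"

text \<open>Up to parallel edges the graph is a 4-cycle. Opposite vertices have the same neighbours,
  so one vertex of each opposite pair can go.\<close>

lemma reduce_cyl_2_2: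
  "same_simple_homotopy_type (cyl 2 2 s) (suspended_points 0 (s + 1))"
  by (rule reduce_cyl[of cyl_2_2_moves _ _
      "[((1,2),(2,2))]"
      "[]"];
      code_simp)

definition cyl_2_3_moves :: "(nat \<times> nat) move list" where
  "cyl_2_3_moves =
    [Rem (1,1) (1,2) [] (2,3),
     Del (2,3) [] (1,1),
     Rem (1,1) (1,3) [] (2,2),
     Del (2,2) [] (1,1)]"

lemma reduce_cyl_2_3:
  "same_simple_homotopy_type (cyl 2 3 s) (suspended_points 0 (s + 2))"
  by (rule reduce_cyl[of cyl_2_3_moves _ _
      "[((1,1),(2,1)), ((1,2),(1,3))]"
      "[]"];
      code_simp)

definition cyl_2_4_moves :: "(nat \<times> nat) move list" where
  "cyl_2_4_moves =
    [Add (1,4) (2,1) [] (1,2),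
     Rem (1,3) (1,4) [] (2,2),
     Del (2,2) [] (1,3),
     Add (1,1) (2,4) [] (1,3),
     Rem (2,3) (2,4) [] (1,2),
     Del (1,2) [] (2,3)]"

text \<open>The graph is that of the cube. Its independence complex consists of two tetrahedra, one
  on each colour class, and four edges joining antipodes; shrinking the tetrahedra gives the
  suspension of four points.\<close>

lemma reduce_cyl_2_4:
  "same_simple_homotopy_type (cyl 2 4 s) (suspended_points 4 (s + 1))"
  by (rule reduce_cyl[of cyl_2_4_moves _ _
      "[((1,3),(2,3))]"
      "[(1,1), (1,4), (2,1), (2,4)]"];
      code_simp)

definition cyl_2_5_moves :: "(nat \<times> nat) move list" where
  "cyl_2_5_moves =
    [Del (2,4) [((2,1),(1,2))] (1,3),
     Del (1,2) [] (2,3),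
     Del (2,5) [] (1,1),
     Del (1,3) [((2,2),(1,1))] (1,5),
     Del (2,1) [] (2,3),
     Del (1,4) [] (1,1)]"

lemma reduce_cyl_2_5:
  "same_simple_homotopy_type (cyl 2 5 s) (suspended_points 0 (s + 2))"
  by (rule reduce_cyl[of cyl_2_5_moves _ _
      "[((1,1),(1,5)), ((2,2),(2,3))]"
      "[]"];
      code_simp)

section \<open>Base cases with three rows: 2 to 9 columns\<close>

definition cyl_3_2_moves :: "(nat \<times> nat) move list" where
  "cyl_3_2_moves =
    [Del (2,1) [] (1,2),
     Del (2,2) [] (1,1)]"

lemma reduce_cyl_3_2:
  "same_simple_homotopy_type (cyl 3 2 s) (suspended_points 0 (s + 2))"
  by (rule reduce_cyl[of cyl_3_2_moves _ _
      "[((1,1),(1,2)), ((3,1),(3,2))]"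
      "[]"];
      code_simp)

definition cyl_3_3_moves :: "(nat \<times> nat) move list" where
  "cyl_3_3_moves =
    [Del (3,3) [((2,1),(1,2)), ((2,2),(1,1))] (1,3),
     Del (2,2) [] (3,1),
     Del (2,1) [] (3,2),
     Del (1,2) [] (2,3),
     Del (2,3) [] (1,1)]"

lemma reduce_cyl_3_3:
  "same_simple_homotopy_type (cyl 3 3 s) (suspended_points 0 (s + 2))"
  by (rule reduce_cyl[of cyl_3_3_moves _ _
      "[((1,1),(1,3)), ((3,1),(3,2))]"
      "[]"];
      code_simp)

definition cyl_3_4_moves :: "(nat \<times> nat) move list" where
  "cyl_3_4_moves =
    [Rem (1,3) (2,3) [((1,1),(3,1))] (3,2),
     Del (1,1) [] (1,3),
     Rem (1,2) (2,2) [((3,1),(2,4))] (1,4),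
     Del (1,4) [] (1,2),
     Add (3,2) (3,4) [] (2,1),
     Add (3,1) (3,3) [] (2,2),
     Rem (2,3) (3,3) [] (2,1),
     Del (2,1) [] (2,3),
     Rem (2,4) (3,4) [] (2,2),
     Del (2,2) [] (2,4)]"

text \<open>The four points are the vertices of row 3: both diagonals of this 4-cycle are added, and
  the row is separated from the rest.\<close>

lemma reduce_cyl_3_4:
  "same_simple_homotopy_type (cyl 3 4 s) (suspended_points 4 (s + 2))"
  by (rule reduce_cyl[of cyl_3_4_moves _ _
      "[((1,2),(1,3)), ((2,3),(2,4))]"
      "[(3,1), (3,2), (3,3), (3,4)]"];
      code_simp)

definition cyl_3_5_moves :: "(nat \<times> nat) move list" where
  "cyl_3_5_moves =
    [Del (2,5) [((1,1),(1,3))] (1,4),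
     Del (2,2) [((1,1),(1,4))] (1,3),
     Del (2,4) [((1,3),(1,1))] (1,5),
     Del (2,1) [((1,2),(1,4))] (1,5),
     Del (2,3) [((1,2),(1,5))] (1,4),
     Rem (1,4) (1,5) [] (1,2),
     Del (1,2) [] (1,4),
     Rem (3,4) (3,5) [] (3,2),
     Del (3,2) [] (3,4)]"

text \<open>The middle row can be deleted completely. Two 5-cycles remain, and each of them yields
  two isolated edges.\<close>

lemma reduce_cyl_3_5:
  "same_simple_homotopy_type (cyl 3 5 s) (suspended_points 0 (s + 4))"
  by (rule reduce_cyl[of cyl_3_5_moves _ _
      "[((1,1),(1,5)), ((1,3),(1,4)), ((3,1),(3,5)), ((3,3),(3,4))]"
      "[]"];
      code_simp)

definition cyl_3_6_moves :: "(nat \<times> nat) move list" where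
  "cyl_3_6_moves =
    [Del (1,2) [((2,1),(3,6)), ((2,3),(3,4)), ((1,4),(2,5))] (3,5),
     Del (2,3) [((3,2),(2,1)), ((1,1),(1,5))] (1,4),
     Del (1,5) [] (1,3),
     Del (2,5) [((2,2),(3,1))] (3,6),
     Del (2,1) [] (1,6),
     Del (2,6) [] (1,1),
     Del (3,3) [] (2,2),
     Del (2,4) [] (1,3),
     Del (3,6) [] (3,4),
     Del (3,1) [] (2,2)]"

lemma reduce_cyl_3_6:
  "same_simple_homotopy_type (cyl 3 6 s) (suspended_points 0 (s + 4))"
  by (rule reduce_cyl[of cyl_3_6_moves _ _
      "[((1,1),(1,6)), ((1,3),(1,4)), ((2,2),(3,2)), ((3,4),(3,5))]"
      "[]"];
      code_simp)

definition cyl_3_7_moves :: "(nat \<times> nat) move list" where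
  "cyl_3_7_moves =
    [Rem (1,1) (1,7) [((2,2),(3,3)), ((1,3),(2,4)), ((3,4),(2,5)), ((3,4),(3,6))] (2,6),
     Del (2,2) [] (1,1),
     Del (3,4) [((3,2),(2,1)), ((1,1),(1,3))] (2,3),
     Del (2,6) [] (3,5),
     Add (1,3) (3,1) [] (1,1),
     Rem (1,1) (1,2) [((1,4),(2,5)), ((3,5),(3,7)), ((3,1),(3,3)), ((2,3),(1,4)), ((1,5),(1,7))]
       (2,7),
     Del (1,4) [] (1,2),
     Del (2,7) [] (1,1),
     Del (1,5) [] (1,7),
     Del (2,3) [] (1,2),
     Del (3,5) [] (2,4),
     Del (3,1) [] (1,1)]"

lemma reduce_cyl_3_7:
  "same_simple_homotopy_type (cyl 3 7 s) (suspended_points 0 (s + 6))"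
  by (rule reduce_cyl[of cyl_3_7_moves _ _
      "[((1,1),(2,1)), ((1,2),(1,3)), ((1,6),(1,7)), ((2,4),(2,5)), ((3,2),(3,3)), ((3,6),(3,7))]"
      "[]"];
      code_simp)

text \<open>The search leads to a complex that is an iterated suspension of the graph \<open>K\<^bsub>3,4\<^esub>\<close> without one
  edge. The vertices in row \<open>4\<close> subdivide edges of this graph in order to contract it to \<open>K\<^bsub>2,6\<^esub>\<close>.\<close>

definition cyl_3_8_moves :: "(nat \<times> nat) move list" where
  "cyl_3_8_moves =
    [Add (2,6) (3,1) [] (3,7),
     Rem (2,6) (2,7) [] (3,8),
     Rem (2,6) (3,6) [((1,7),(2,8))] (3,8),
     Del (3,8) [((3,6),(2,5)), ((2,6),(1,7))] (2,7),
     Add (1,7) (3,4) [((3,2),(2,1))] (2,8),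
     Add (1,4) (3,1) [((2,5),(3,6)), ((1,6),(2,7))] (3,7),
     Add (2,6) (3,2) [((2,3),(1,4))] (1,5),
     Rem (1,7) (1,8) [((2,1),(3,2)), ((1,2),(2,3))] (3,3),
     Del (3,3) [((2,2),(1,1)), ((2,4),(1,5)), ((1,8),(2,1)), ((1,8),(2,7)), ((1,7),(2,6)),
       ((3,1),(2,4)), ((2,5),(3,6))] (3,7),
     Del (2,1) [] (1,8),
     Rem (2,2) (3,2) [((1,3),(2,4)), ((1,3),(1,5)), ((2,5),(3,6)), ((1,6),(2,7))] (3,7),
     Del (1,3) [] (2,2),
     Add (1,7) (3,5) [] (3,7),
     Add (2,4) (3,5) [((2,2),(1,1)), ((3,7),(2,8))] (1,8),
     Add (1,6) (2,5) [] (3,4),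
     Add (2,8) (3,4) [((1,1),(2,2))] (2,3),
     Add (1,1) (1,7) [] (2,8),
     Rem (1,6) (1,7) [((1,2),(2,3)), ((3,2),(1,4))] (2,4),
     Del (2,4) [((2,2),(1,1)), ((3,6),(2,7))] (1,7),
     Del (1,2) [] (2,3),
     Rem (2,6) (3,1) [] (1,5),
     Add (2,5) (2,7) [] (3,4),
     Rem (1,7) (3,5) [] (3,7),
     Rem (1,7) (2,7) [] (1,8),
     Add (1,4) (1,6) [] (3,2),
     Rem (2,5) (2,7) [] (3,6),
     Add (3,5) (3,7) [((1,7),(1,8))] (2,8),
     Add (1,5) (2,6) [] (3,1),
     Rem (1,8) (2,8) [] (1,7),
     Del (1,7) [] (1,8),
     Rem (1,4) (1,6) [] (3,2),
     Rem (1,4) (1,5) [] (3,2),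
     Del (3,2) [] (1,4),
     Rem (2,7) (3,7) [] (3,4),
     Del (3,4) [] (2,7),
     Ins (4,1) [(1,5), (1,6), (2,5), (3,6), (3,7)] [] (3,5),
     Add (3,5) (2,6) [] (4,1),
     Ins (4,2) [(1,5), (1,6), (2,5), (3,5), (3,6), (3,7)] [] (2,6),
     Add (4,1) (2,6) [] (4,2),
     Ins (4,3) [(1,5), (2,5), (2,6), (3,6), (3,7), (4,1), (4,2)] [] (3,5),
     Add (3,5) (1,6) [] (4,3),
     Ins (4,4) [(1,5), (2,5), (2,6), (3,5), (3,6), (3,7), (4,1), (4,2)] [] (1,6),
     Add (4,3) (1,6) [] (4,4),
     Rem (3,5) (3,7) [] (1,5),
     Rem (3,7) (4,1) [] (3,5),
     Rem (3,7) (4,3) [] (3,5),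
     Del (3,5) [] (3,7),
     Rem (3,6) (4,2) [] (2,6),
     Add (4,2) (2,6) [] (3,6),
     Rem (3,7) (4,2) [] (4,1),
     Del (4,1) [] (3,7),
     Rem (3,6) (4,4) [] (1,6),
     Add (4,4) (1,6) [] (3,6),
     Rem (3,7) (4,4) [] (4,3),
     Del (4,3) [] (3,7)]"

text \<open>Just before the first insertion, and up to suspension, the complex joins
  \<open>(3,5)\<close>, \<open>(3,6)\<close>, \<open>(3,7)\<close> to \<open>(1,5)\<close>,
  \<open>(1,6)\<close>, \<open>(2,5)\<close>, \<open>(2,6)\<close>, except that \<open>(3,5)\<close>
  and \<open>(2,5)\<close> are not joined. The edges from \<open>(3,5)\<close> to
  \<open>(2,6)\<close> and \<open>(1,6)\<close> are subdivided, and \<open>(3,5)\<close> is merged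
  into \<open>(3,7)\<close> by way of \<open>(1,5)\<close>. The far ends of the two paths then slide
  to \<open>(3,6)\<close>, and the paths shrink until only \<open>(4,2)\<close> and
  \<open>(4,4)\<close> remain between \<open>(3,6)\<close> and \<open>(3,7)\<close>.\<close>

lemma reduce_cyl_3_8:
  "same_simple_homotopy_type (cyl 3 8 s) (suspended_points 6 (s + 5))"
  by (rule reduce_cyl[of cyl_3_8_moves _ _
      "[((1,1),(1,8)), ((1,4),(3,1)), ((2,2),(2,3)), ((2,7),(2,8)), ((3,6),(3,7))]"
      "[(1,5), (1,6), (2,5), (2,6), (4,2), (4,4)]"];
      code_simp)

definition cyl_3_9_moves :: "(nat \<times> nat) move list" where
  "cyl_3_9_moves =
    [Del (3,4) [((3,2),(2,1)), ((2,3),(1,2)), ((1,1),(1,8)), ((2,5),(1,6)), ((3,6),(2,7))]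
       (1,7),
     Del (1,5) [((1,3),(2,2)), ((2,4),(3,3)), ((3,2),(3,9)), ((3,5),(3,7)), ((1,7),(2,8))]
       (3,8),
     Del (2,5) [((1,4),(1,2)), ((1,1),(2,9)), ((1,6),(1,8)), ((1,6),(2,7)), ((3,6),(3,8))]
       (2,8),
     Del (3,7) [] (3,5),
     Del (2,9) [] (3,8),
     Del (1,8) [((3,5),(2,6))] (1,6),
     Del (1,3) [] (2,4),
     Del (2,6) [] (3,5),
     Del (2,1) [] (1,2),
     Del (2,2) [] (3,3),
     Del (3,9) [((1,6),(2,7))] (2,8),
     Del (2,3) [] (1,4),
     Del (1,2) [] (1,9),
     Del (2,7) [] (1,6),
     Del (3,3) [] (3,1)]"

lemma reduce_cyl_3_9:
  "same_simple_homotopy_type (cyl 3 9 s) (suspended_points 0 (s + 6))"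
  by (rule reduce_cyl[of cyl_3_9_moves _ _
      "[((1,1),(1,9)), ((1,4),(2,4)), ((1,6),(1,7)), ((2,8),(3,8)), ((3,1),(3,2)), ((3,5),(3,6))]"
      "[]"];
      code_simp)

section \<open>Wedges of spheres\<close>

definition cross_adj :: "nat \<times> nat \<Rightarrow> nat \<times> nat \<Rightarrow> bool" where
  "cross_adj x y \<longleftrightarrow> fst x = fst y \<and> snd x \<noteq> snd y"

abbreviation cross_verts :: "nat \<Rightarrow> (nat \<times> nat) set" where
  "cross_verts r \<equiv> {..<r} \<times> {0, 1}"

text \<open>Choosing a proper subset of \<open>{0, 1}\<close> in every factor means never taking
  both ends of a pair. Spheres thus become independence complexes of disjoint edges and can be
  compared with the reduced cylinders.\<close>

lemma join_power_simplex_boundary: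
  "join_power r (simplex_boundary 1) = ind (cross_verts r) cross_adj"
proof (intro set_eqI iffI)
  fix S assume "S \<in> join_power r (simplex_boundary 1)"
  then obtain s where S: "S = (\<Union>c<r. Pair c ` s c)" and s: "\<And>c. c < r \<Longrightarrow> s c \<subset> {0..1}"
    unfolding join_power_def simplex_boundary_def by auto
  have "S \<subseteq> cross_verts r"
  proof
    fix z assume "z \<in> S"
    then obtain c x where "z = (c, x)" "c < r" "x \<in> s c" using S by auto
    moreover have "x \<in> {0, 1}" using s[OF \<open>c < r\<close>] \<open>x \<in> s c\<close> by (auto simp: atLeastAtMost_iff)
    ultimately show "z \<in> cross_verts r" by simp
  qed
  moreover have "\<not> cross_adj (c, x) (d, y)" if "(c, x) \<in> S" "(d, y) \<in> S" for c d x y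
  proof
    assume "cross_adj (c, x) (d, y)"
    then have *: "d = c" "x \<noteq> y" unfolding cross_adj_def by auto
    have c: "c < r" "x \<in> s c" "y \<in> s c" using that S * by auto
    have "s c \<subseteq> {0, 1}" "x \<in> {0, 1}" "y \<in> {0, 1}" using s[OF c(1)] c by (auto simp: atLeastAtMost_iff)
    then have "{0, 1} \<subseteq> s c" using c * by auto
    moreover have "{0..1} = {0, 1::nat}" by auto
    ultimately show False using s[OF c(1)] by auto
  qed
  ultimately show "S \<in> ind (cross_verts r) cross_adj" unfolding ind_iff by auto
next
  fix S assume S: "S \<in> ind (cross_verts r) cross_adj"
  let ?s = "\<lambda>c. {x. (c, x) \<in> S}"
  have sub: "S \<subseteq> cross_verts r" using S by (simp add: ind_iff)
  have "S = (\<Union>c<r. Pair c ` ?s c)" using sub by auto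
  moreover have "?s c \<subset> {0..1}" for c
  proof -
    have "?s c \<subseteq> {0..1}" using sub by auto
    moreover have "\<not> ((c, 0) \<in> S \<and> (c, 1) \<in> S)"
    proof -
      have "cross_adj (c, 0) (c, 1)" by (simp add: cross_adj_def)
      then show ?thesis using S unfolding ind_iff by metis
    qed
    then have "?s c \<noteq> {0..1}" by (metis atLeastAtMost_iff le0 mem_Collect_eq order_refl)
    ultimately show ?thesis by (rule psubsetI)
  qed
  ultimately show "S \<in> join_power r (simplex_boundary 1)"
    unfolding join_power_def simplex_boundary_def by (intro CollectI exI[of _ ?s]) simp
qed

lemma diamond_eq_ind: "nat (n + 1) = r \<Longrightarrow> diamond n = ind (cross_verts r) cross_adj"
  unfolding diamond_def by (simp only: join_power_simplex_boundary)

lemma suspended_points_0: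
  "same_simple_homotopy_type (suspended_points 0 s) (diamond (int s - 1))"
proof -
  let ?h = "\<lambda>(c, x). (0::nat, 2 * c + x)"
  have eq: "suspended_points 0 s = ind ({0} \<times> {..<2 * s}) (\<lambda>x y. pad_adj x y \<or> clique_adj x y)"
    unfolding padded_def by simp
  have "same_simple_homotopy_type (suspended_points 0 s) (ind (cross_verts s) cross_adj)"
    unfolding eq
  proof (rule ind_iso)
    show "bij_betw ?h (cross_verts s) ({0} \<times> {..<2 * s})"
      by (rule bij_betw_byWitness[where f' = "\<lambda>(_, k). (k div 2, k mod 2)"]) auto
    show "cross_adj x y \<longleftrightarrow> pad_adj (?h x) (?h y) \<or> clique_adj (?h x) (?h y)"
      if "x \<in> cross_verts s" "y \<in> cross_verts s" for x y
      using that by (auto simp: cross_adj_def pad_adj_def clique_adj_def) presburger+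
  qed simp
  then show ?thesis using diamond_eq_ind[of "int s - 1" s] by simp
qed

text \<open>Loops are allowed in \<open>B\<close>: they delete vertices.\<close>

lemma ind_add_edges:
  assumes "finite V"
    and "\<And>x y. x \<in> V \<Longrightarrow> y \<in> V \<Longrightarrow> B x y \<Longrightarrow> \<exists>w\<in>V. w \<noteq> x \<and> w \<noteq> y \<and> \<not> E w w \<and> \<not> B w w \<and>
      (\<forall>z\<in>V. \<not> E x z \<and> \<not> E z x \<and> \<not> E y z \<and> \<not> E z y \<longrightarrow> \<not> E w z \<and> \<not> E z w \<and> \<not> B w z \<and> \<not> B z w)"
  shows "same_simple_homotopy_type (ind V E) (ind V (\<lambda>x y. E x y \<or> B x y))"
proof -
  \<comment> \<open>\<open>P \<sigma> w\<close> makes \<open>w\<close> fit for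
    \<open>collapse_stars\<close>: the conditions on \<open>E\<close> make it an apex over
    \<open>\<sigma>\<close>, those on \<open>B\<close> prevent it from completing a further pair of
    \<open>S\<close>.\<close>
  define P where "P \<sigma> w \<longleftrightarrow> w \<in> V \<and> w \<notin> \<sigma> \<and> \<not> E w w \<and> \<not> B w w \<and>
    (\<forall>\<rho>\<in>ind V E. \<sigma> \<subseteq> \<rho> \<longrightarrow> (\<forall>z\<in>\<rho>. \<not> E w z \<and> \<not> E z w \<and> \<not> B w z \<and> \<not> B z w))" for \<sigma> w
  define S where "S = {{x, y} | x y. x \<in> V \<and> y \<in> V \<and> B x y}"
  have "\<exists>w. P \<sigma> w" if \<sigma>S: "\<sigma> \<in> S" for \<sigma>
  proof -
    obtain x y where \<sigma>: "\<sigma> = {x, y}" "x \<in> V" "y \<in> V" "B x y" using \<sigma>S unfolding S_def by blast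
    obtain w where w: "w \<in> V" "w \<noteq> x" "w \<noteq> y" "\<not> E w w" "\<not> B w w"
      "\<forall>z\<in>V. \<not> E x z \<and> \<not> E z x \<and> \<not> E y z \<and> \<not> E z y \<longrightarrow> \<not> E w z \<and> \<not> E z w \<and> \<not> B w z \<and> \<not> B z w"
      using assms(2)[OF \<sigma>(2-4)] by auto
    have "\<not> E w z \<and> \<not> E z w \<and> \<not> B w z \<and> \<not> B z w" if "\<rho> \<in> ind V E" "\<sigma> \<subseteq> \<rho>" "z \<in> \<rho>" for \<rho> z
    proof -
      have "x \<in> \<rho>" "y \<in> \<rho>" using that(2) \<sigma>(1) by auto
      then have "z \<in> V" "\<not> E x z \<and> \<not> E z x \<and> \<not> E y z \<and> \<not> E z y" using that(1,3) by (auto simp: ind_iff)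
      then show ?thesis using w(6) by blast
    qed
    then have "P \<sigma> w" unfolding P_def using w \<sigma>(1) by simp
    then show ?thesis by blast
  qed
  then obtain f where f: "\<And>\<sigma>. \<sigma> \<in> S \<Longrightarrow> P \<sigma> (f \<sigma>)" by metis
  have "same_simple_homotopy_type (ind V E) {\<rho>\<in>ind V E. \<forall>\<sigma>\<in>S. \<not> \<sigma> \<subseteq> \<rho>}"
  proof (rule collapse_stars)
    have "S \<subseteq> Pow V" unfolding S_def by auto
    then show "finite S" using assms(1) finite_subset by blast
    show "finite_complex (ind V E)" using assms(1) by (rule finite_complex_ind)
    show "{} \<notin> S" unfolding S_def by auto
    show "f \<sigma> \<notin> \<sigma>" if "\<sigma> \<in> S" for \<sigma> using f[OF that] unfolding P_def by simp
    show "insert (f \<sigma>) \<rho> \<in> ind V E" if "\<sigma> \<in> S" "\<rho> \<in> ind V E" "\<sigma> \<subseteq> \<rho>" for \<sigma> \<rho>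
      using f[OF that(1)] that(2,3) unfolding P_def by (simp add: ind_iff)
    show "\<sigma>' \<subseteq> \<rho>"
      if *: "\<sigma> \<in> S" "\<rho> \<in> ind V E" "\<sigma> \<subseteq> \<rho>" "\<sigma>' \<in> S" "\<sigma>' \<subseteq> insert (f \<sigma>) \<rho>" for \<sigma> \<rho> \<sigma>'
    proof -
      obtain x y where xy: "\<sigma>' = {x, y}" "B x y" using *(4) unfolding S_def by blast
      have P: "\<not> B (f \<sigma>) (f \<sigma>)" "\<forall>z\<in>\<rho>. \<not> B (f \<sigma>) z \<and> \<not> B z (f \<sigma>)"
        using f[OF *(1)] *(2,3) unfolding P_def by simp_all
      have "x = f \<sigma> \<or> x \<in> \<rho>" "y = f \<sigma> \<or> y \<in> \<rho>" using *(5) xy(1) by auto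
      then have "x \<in> \<rho>" "y \<in> \<rho>" using P xy(2) by auto
      then show ?thesis using xy(1) by simp
    qed
  qed
  moreover have "{\<rho>\<in>ind V E. \<forall>\<sigma>\<in>S. \<not> \<sigma> \<subseteq> \<rho>} = ind V (\<lambda>x y. E x y \<or> B x y)"
  proof -
    have "\<rho> \<in> {\<rho>\<in>ind V E. \<forall>\<sigma>\<in>S. \<not> \<sigma> \<subseteq> \<rho>} \<longleftrightarrow> \<rho> \<in> ind V (\<lambda>x y. E x y \<or> B x y)" for \<rho>
    proof (cases "\<rho> \<subseteq> V")
      case True
      then have "(\<forall>\<sigma>\<in>S. \<not> \<sigma> \<subseteq> \<rho>) \<longleftrightarrow> (\<forall>x\<in>\<rho>. \<forall>y\<in>\<rho>. \<not> B x y)"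
      proof (intro iffI ballI notI)
        fix x y assume *: "\<forall>\<sigma>\<in>S. \<not> \<sigma> \<subseteq> \<rho>" "x \<in> \<rho>" "y \<in> \<rho>" "B x y"
        then have "{x, y} \<in> S" using True unfolding S_def by blast
        with *(1) have "\<not> {x, y} \<subseteq> \<rho>" by (rule bspec)
        then show False using *(2,3) by simp
      next
        fix \<sigma> assume *: "\<forall>x\<in>\<rho>. \<forall>y\<in>\<rho>. \<not> B x y" "\<sigma> \<in> S" "\<sigma> \<subseteq> \<rho>"
        then obtain x y where "\<sigma> = {x, y}" "B x y" unfolding S_def by blast
        then show False using * by simp
      qed
      then show ?thesis by (auto simp: ind_iff)
    qed (simp add: ind_iff)
    then show ?thesis by (rule set_eqI)
  qed
  ultimately show ?thesis by simp
qed

section \<open>Independence of the wedge from the attaching vertices\<close>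

lemma mem_wedge:
  "\<tau> \<in> wedge r b K \<longleftrightarrow> (\<exists>c<r. \<exists>\<sigma>\<in>K. \<tau> = (\<lambda>v. if v = b c then (0, b 0) else (c, v)) ` \<sigma>)"
proof -
  let ?e = "\<lambda>(c, v). if v = b c then (0, b 0) else (c, v)"
  have "?e ` Pair c ` \<sigma> = (\<lambda>v. if v = b c then (0, b 0) else (c, v)) ` \<sigma>" for c \<sigma>
    unfolding image_image split_conv ..
  moreover have "\<tau> \<in> wedge r b K \<longleftrightarrow> (\<exists>c<r. \<exists>\<sigma>\<in>K. \<tau> = ?e ` Pair c ` \<sigma>)"
    unfolding wedge_def disjoint_copies_def by blast
  ultimately show ?thesis by (simp only:)
qed

text \<open>Each copy is moved by its own automorphism. This respects the gluing, because all
  \<open>b c\<close> represent one point and \<open>\<phi> 0\<close> moves its name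
  \<open>(0, b 0)\<close> to \<open>(0, b' 0)\<close>.\<close>

lemma wedge_base_iso:
  assumes inj: "\<And>c. c < r \<Longrightarrow> inj_on (\<phi> c) (\<Union>K)" and img: "\<And>c. c < r \<Longrightarrow> (`) (\<phi> c) ` K = K"
    and b: "\<And>c. c < r \<Longrightarrow> b c \<in> \<Union>K" "\<And>c. c < r \<Longrightarrow> \<phi> c (b c) = b' c" and "0 < r"
  shows "simplicial_iso (wedge r b K) (wedge r b' K)"
proof -
  let ?g = "\<lambda>(c, v). (c, \<phi> c v)"
  let ?e = "\<lambda>b c v. if v = b c then (0::nat, b 0) else (c, v)"
  have ge: "?g (?e b c v) = ?e b' c (\<phi> c v)" if "c < r" "v \<in> \<Union>K" for c v
  proof (cases "v = b c")
    case True
    then show ?thesis using b(2)[OF that(1)] b(2)[OF \<open>0 < r\<close>] by simp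
  next
    case False
    then have "\<phi> c v \<noteq> b' c"
      using inj_onD[OF inj[OF that(1)] _ that(2) b(1)[OF that(1)]] b(2)[OF that(1)] by metis
    then show ?thesis using False by simp
  qed
  have im: "?g ` ?e b c ` \<sigma> = ?e b' c ` \<phi> c ` \<sigma>" if "c < r" "\<sigma> \<in> K" for c \<sigma>
    unfolding image_image
  proof (rule image_cong[OF refl])
    fix v assume "v \<in> \<sigma>"
    with \<open>\<sigma> \<in> K\<close> have "v \<in> \<Union>K" by (rule UnionI)
    then show "?g (?e b c v) = ?e b' c (\<phi> c v)" using ge[OF that(1)] by blast
  qed
  have "\<tau> \<in> (`) ?g ` wedge r b K \<longleftrightarrow> \<tau> \<in> wedge r b' K" for \<tau>
  proof
    assume "\<tau> \<in> (`) ?g ` wedge r b K"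
    then obtain c \<sigma> where c: "c < r" "\<sigma> \<in> K" "\<tau> = ?g ` ?e b c ` \<sigma>" unfolding image_iff Bex_def mem_wedge by blast
    have "\<phi> c ` \<sigma> \<in> K" using img[OF c(1)] c(2) by blast
    then show "\<tau> \<in> wedge r b' K" unfolding mem_wedge c(3) im[OF c(1,2)] using c(1) by blast
  next
    assume "\<tau> \<in> wedge r b' K"
    then obtain c \<sigma>' where c: "c < r" "\<sigma>' \<in> K" "\<tau> = ?e b' c ` \<sigma>'" unfolding mem_wedge by blast
    obtain \<sigma> where \<sigma>: "\<sigma> \<in> K" "\<sigma>' = \<phi> c ` \<sigma>" using img[OF c(1)] c(2) by blast
    have "\<tau> = ?g ` ?e b c ` \<sigma>" unfolding c(3) \<sigma>(2) im[OF c(1) \<sigma>(1)] ..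
    moreover have "?e b c ` \<sigma> \<in> wedge r b K" unfolding mem_wedge using c(1) \<sigma>(1) by blast
    ultimately show "\<tau> \<in> (`) ?g ` wedge r b K" by (rule image_eqI)
  qed
  then have "(`) ?g ` wedge r b K = wedge r b' K" by (rule set_eqI)
  moreover have "inj_on ?g (\<Union>(wedge r b K))"
  proof (rule inj_onI)
    have mem: "c < r \<and> v \<in> \<Union>K" if v: "(c, v) \<in> \<Union>(wedge r b K)" for c v
    proof -
      obtain d \<sigma> where d: "d < r" "\<sigma> \<in> K" "(c, v) \<in> ?e b d ` \<sigma>" using v unfolding Union_iff Bex_def mem_wedge by blast
      then obtain u where "u \<in> \<sigma>" "(c, v) = ?e b d u" by blast
      then show ?thesis using d b(1) \<open>0 < r\<close> by (auto split: if_splits)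
    qed
    fix x y assume xy: "x \<in> \<Union>(wedge r b K)" "y \<in> \<Union>(wedge r b K)" "?g x = ?g y"
    obtain c v d w where eq: "x = (c, v)" "y = (d, w)" by (cases x, cases y)
    have "d = c" "\<phi> c v = \<phi> c w" using xy(3) eq by auto
    moreover have "c < r" "v \<in> \<Union>K" "w \<in> \<Union>K"
      using mem xy(1,2) unfolding eq \<open>d = c\<close> by metis+
    ultimately show "x = y" using inj_onD[OF inj] eq by metis
  qed
  ultimately show ?thesis using simplicial_iso_image[of ?g "wedge r b K"] by simp
qed

text \<open>An involution of the cross-polytope boundary that brings \<open>p\<close> to
  \<open>(0, 0)\<close>: it exchanges the antipodal pair of \<open>p\<close> with pair
  \<open>0\<close>, reversing both if \<open>p\<close> is the second vertex of its pair.\<close>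

definition to_base :: "nat \<times> nat \<Rightarrow> nat \<times> nat \<Rightarrow> nat \<times> nat" where
  "to_base p v = (if fst v = fst p \<or> fst v = 0
     then (if fst v = 0 then fst p else 0, if snd p = 0 then snd v else 1 - snd v) else v)"

lemma Union_cross: "\<Union>(ind (cross_verts r) cross_adj) = cross_verts r"
proof (intro set_eqI iffI)
  fix x assume "x \<in> cross_verts r"
  then have "{x} \<in> ind (cross_verts r) cross_adj" by (simp add: ind_iff cross_adj_def)
  then show "x \<in> \<Union>(ind (cross_verts r) cross_adj)" by blast
qed (auto simp: ind_iff)

lemma to_base_invol:
  assumes "p \<in> cross_verts r" "v \<in> cross_verts r"
  shows "to_base p v \<in> cross_verts r" "to_base p (to_base p v) = v" "to_base p p = (0, 0)"
  using assms by (auto simp: to_base_def)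

lemma to_base_cross_adj:
  assumes "p \<in> cross_verts r" "v \<in> cross_verts r" "w \<in> cross_verts r"
  shows "cross_adj (to_base p v) (to_base p w) \<longleftrightarrow> cross_adj v w"
  using assms by (auto simp: to_base_def cross_adj_def)

lemma to_base_automorphism:
  assumes p: "p \<in> cross_verts r"
  shows "(`) (to_base p) ` ind (cross_verts r) cross_adj = ind (cross_verts r) cross_adj"
proof -
  let ?K = "ind (cross_verts r) cross_adj" and ?f = "to_base p"
  have img: "?f ` S \<in> ?K" if "S \<in> ?K" for S
  proof -
    have sub: "v \<in> cross_verts r" if "v \<in> S" for v using \<open>S \<in> ?K\<close> that by (auto simp: ind_iff)
    then have "?f ` S \<subseteq> cross_verts r" using to_base_invol(1)[OF p] by blast
    moreover have "\<not> cross_adj (?f v) (?f w)" if "v \<in> S" "w \<in> S" for v w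
      using to_base_cross_adj[OF p sub sub, OF that] \<open>S \<in> ?K\<close> that by (simp add: ind_iff)
    ultimately show ?thesis by (simp add: ind_iff)
  qed
  have "S \<in> (`) ?f ` ?K" if "S \<in> ?K" for S
  proof (rule image_eqI)
    have "?f (?f v) = v" if "v \<in> S" for v
      using \<open>S \<in> ?K\<close> that to_base_invol(2)[OF p, of v] by (auto simp: ind_iff)
    then show "S = ?f ` ?f ` S" by (simp add: image_image)
    show "?f ` S \<in> ?K" using img that .
  qed
  then show ?thesis using img by blast
qed

lemma wedge_diamond_base:
  assumes "0 < r" and b: "\<And>c. c < r \<Longrightarrow> b c \<in> cross_verts q"
  shows "simplicial_iso (wedge r b (ind (cross_verts q) cross_adj))
    (wedge r (\<lambda>_. (0, 0)) (ind (cross_verts q) cross_adj))"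
proof (rule wedge_base_iso[where \<phi> = "\<lambda>c. to_base (b c)"])
  fix c assume c: "c < r"
  show "inj_on (to_base (b c)) (\<Union>(ind (cross_verts q) cross_adj))"
    unfolding Union_cross by (rule inj_on_inverseI[of _ "to_base (b c)"]) (rule to_base_invol(2)[OF b[OF c]])
  show "(`) (to_base (b c)) ` ind (cross_verts q) cross_adj = ind (cross_verts q) cross_adj"
    using to_base_automorphism[OF b[OF c]] .
  show "b c \<in> \<Union>(ind (cross_verts q) cross_adj)" unfolding Union_cross using b[OF c] .
  show "to_base (b c) (b c) = (0, 0)" using to_base_invol(3)[OF b[OF c] b[OF c]] .
qed (rule \<open>0 < r\<close>)

text \<open>The vertex \<open>(c, v)\<close> of a wedge at \<open>(0, 0)\<close> lies in copy \<open>c\<close>. Two vertices are compatible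
  under \<open>merged_adj\<close> if they are compatible after all copies of the equator, the vertices with
  \<open>fst v \<ge> 1\<close>, have been superimposed; the antipodes \<open>(c, (0, 1))\<close> of the base point stay distinct.\<close>

definition wedge_verts :: "nat \<Rightarrow> nat \<Rightarrow> (nat \<times> nat \<times> nat) set" where
  "wedge_verts r q = {(c, v). c < r \<and> v \<in> cross_verts q \<and> (v = (0, 0) \<longrightarrow> c = 0)}"

definition merged_adj :: "nat \<times> nat \<times> nat \<Rightarrow> nat \<times> nat \<times> nat \<Rightarrow> bool" where
  "merged_adj = (\<lambda>(c, i, a) (d, j, b). i = j \<and> (a \<noteq> b \<or> i = 0 \<and> a \<noteq> 0 \<and> c \<noteq> d))"

definition pole_adj :: "nat \<times> nat \<times> nat \<Rightarrow> nat \<times> nat \<times> nat \<Rightarrow> bool" where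
  "pole_adj = (\<lambda>(c, i, a) (d, j, b). c \<noteq> d \<and> (i = 0 \<and> a \<noteq> 0 \<and> j \<noteq> 0 \<or> i \<noteq> 0 \<and> j = 0 \<and> b \<noteq> 0))"

definition equator_adj :: "nat \<times> nat \<times> nat \<Rightarrow> nat \<times> nat \<times> nat \<Rightarrow> bool" where
  "equator_adj = (\<lambda>(c, i, a) (d, j, b). c \<noteq> d \<and> i \<noteq> 0 \<and> j \<noteq> 0)"

lemma finite_wedge_verts: "finite (wedge_verts r q)"
proof (rule finite_subset)
  show "wedge_verts r q \<subseteq> {..<r} \<times> cross_verts q" unfolding wedge_verts_def by auto
qed simp

text \<open>A face of the wedge must lie in one copy, apart from the base point. Vertices of
  different copies are separated by \<open>merged_adj\<close> if both are antipodes, by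
  \<open>pole_adj\<close> if one is, and by \<open>equator_adj\<close> if none is.\<close>

lemma wedge_base_eq_ind:
  assumes "0 < r" "0 < q"
  shows "wedge r (\<lambda>_. (0, 0)) (ind (cross_verts q) cross_adj) =
    ind (wedge_verts r q) (\<lambda>x y. (merged_adj x y \<or> pole_adj x y) \<or> equator_adj x y)"
proof (intro set_eqI iffI)
  let ?E = "\<lambda>x y. (merged_adj x y \<or> pole_adj x y) \<or> equator_adj x y"
  let ?e = "\<lambda>c v. if v = (0, 0) then (0::nat, (0::nat, 0::nat)) else (c, v)"
  fix \<tau> assume "\<tau> \<in> wedge r (\<lambda>_. (0, 0)) (ind (cross_verts q) cross_adj)"
  then obtain c \<sigma> where c: "c < r" "\<sigma> \<in> ind (cross_verts q) cross_adj" "\<tau> = ?e c ` \<sigma>"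
    unfolding mem_wedge by blast
  have \<sigma>: "v \<in> cross_verts q" if "v \<in> \<sigma>" for v using c(2) that by (auto simp: ind_iff)
  have "?e c v \<in> wedge_verts r q" if "v \<in> \<sigma>" for v
    using \<sigma>[OF that] c(1) \<open>0 < q\<close> by (auto simp: wedge_verts_def)
  moreover have "\<not> ?E (?e c v) (?e c w)" if "v \<in> \<sigma>" "w \<in> \<sigma>" for v w
  proof -
    have "\<not> cross_adj v w" using c(2) that by (simp add: ind_iff)
    then show ?thesis
      by (cases v; cases w) (auto simp: cross_adj_def merged_adj_def pole_adj_def equator_adj_def)
  qed
  ultimately show "\<tau> \<in> ind (wedge_verts r q) ?E" unfolding c(3) ind_iff by (simp only: ball_simps image_subset_iff) blast
next
  let ?E = "\<lambda>x y. (merged_adj x y \<or> pole_adj x y) \<or> equator_adj x y"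
  let ?e = "\<lambda>c v. if v = (0, 0) then (0::nat, (0::nat, 0::nat)) else (c, v)"
  fix \<tau> assume \<tau>: "\<tau> \<in> ind (wedge_verts r q) ?E"
  have mem: "c < r \<and> v \<in> cross_verts q \<and> (v = (0, 0) \<longrightarrow> c = 0)" if "(c, v) \<in> \<tau>" for c v
    using \<tau> that by (auto simp: ind_iff wedge_verts_def)
  have nE: "\<not> ?E x y" if "x \<in> \<tau>" "y \<in> \<tau>" for x y using \<tau> that by (simp add: ind_iff)
  have same: "c = d" if "(c, v) \<in> \<tau>" "(d, w) \<in> \<tau>" "v \<noteq> (0, 0)" "w \<noteq> (0, 0)" for c d v w
  proof -
    obtain i a j b where "v = (i, a)" "w = (j, b)" by (cases v, cases w)
    then show ?thesis
      using nE[OF that(1,2)] that(3,4) mem[OF that(1)] mem[OF that(2)]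
      by (auto simp: merged_adj_def pole_adj_def equator_adj_def)
  qed
  obtain c where c: "c < r" "\<And>d v. (d, v) \<in> \<tau> \<Longrightarrow> v \<noteq> (0, 0) \<Longrightarrow> d = c"
  proof (cases "\<exists>d v. (d, v) \<in> \<tau> \<and> v \<noteq> (0, 0)")
    case True
    then obtain d v where "(d, v) \<in> \<tau>" "v \<noteq> (0, 0)" by blast
    then show ?thesis using that[of d] mem same by blast
  next
    case False
    then show ?thesis using that[OF \<open>0 < r\<close>] by blast
  qed
  let ?\<sigma> = "snd ` \<tau>"
  have "\<tau> = ?e c ` ?\<sigma>"
  proof -
    have "?e c (snd x) = x" if "x \<in> \<tau>" for x
      using mem[of "fst x" "snd x"] c(2)[of "fst x" "snd x"] that by (cases x) auto
    then have "(\<lambda>x. ?e c (snd x)) ` \<tau> = id ` \<tau>" by (intro image_cong) simp_all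
    then show ?thesis unfolding image_image by simp
  qed
  moreover have "?\<sigma> \<in> ind (cross_verts q) cross_adj"
  proof -
    have "\<not> cross_adj v w" if "(d, v) \<in> \<tau>" "(d', w) \<in> \<tau>" for d d' v w
      using nE[OF that] by (cases v; cases w) (auto simp: cross_adj_def merged_adj_def)
    moreover have "snd x \<in> cross_verts q" if "x \<in> \<tau>" for x
      using mem[of "fst x" "snd x"] that by simp
    ultimately show ?thesis unfolding ind_iff ball_simps by (metis image_subsetI prod.collapse)
  qed
  ultimately show "\<tau> \<in> wedge r (\<lambda>_. (0, 0)) (ind (cross_verts q) cross_adj)"
    unfolding mem_wedge using c(1) by blast
qed

text \<open>The order of the two stages matters: only after the edges of \<open>pole_adj\<close> are
  present does the base point become an apex over two equator vertices of different copies.\<close>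

lemma merged_to_wedge:
  assumes "0 < r" "0 < q"
  shows "same_simple_homotopy_type (ind (wedge_verts r q) merged_adj)
    (ind (wedge_verts r q) (\<lambda>x y. (merged_adj x y \<or> pole_adj x y) \<or> equator_adj x y))"
proof (rule same_simple_homotopy_type_trans)
  show "same_simple_homotopy_type (ind (wedge_verts r q) merged_adj)
    (ind (wedge_verts r q) (\<lambda>x y. merged_adj x y \<or> pole_adj x y))"
  proof (rule ind_add_edges[OF finite_wedge_verts])
    fix x y assume xy: "x \<in> wedge_verts r q" "y \<in> wedge_verts r q" "pole_adj x y"
    obtain c i a d j b where eq: "x = (c, i, a)" "y = (d, j, b)" by (cases x, cases y)
    \<comment> \<open>One of \<open>x\<close>, \<open>y\<close> is the antipode of some copy, the
      other an equator vertex of a different copy. The apex is the twin of the equator vertex in the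
      copy of the antipode; the antipode already excludes all other antipodes.\<close>
    define w where "w = (if i = 0 then (c, j, b) else (d, i, a))"
    have "w \<in> wedge_verts r q" "w \<noteq> x" "w \<noteq> y" "\<not> merged_adj w w" "\<not> pole_adj w w"
      using xy unfolding w_def eq by (auto simp: wedge_verts_def pole_adj_def merged_adj_def)
    moreover have "\<not> merged_adj w z \<and> \<not> merged_adj z w \<and> \<not> pole_adj w z \<and> \<not> pole_adj z w"
      if z: "z \<in> wedge_verts r q" "\<not> merged_adj x z \<and> \<not> merged_adj z x \<and> \<not> merged_adj y z \<and> \<not> merged_adj z y" for z
    proof -
      obtain e k f where zeq: "z = (e, k, f)" by (cases z)
      have kx: "k = i \<Longrightarrow> f = a \<and> (i = 0 \<and> a \<noteq> 0 \<longrightarrow> e = c)"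
        and ky: "k = j \<Longrightarrow> f = b \<and> (j = 0 \<and> b \<noteq> 0 \<longrightarrow> e = d)"
        using z(2) unfolding eq zeq merged_adj_def split_conv by metis+
      show ?thesis
      proof (cases "i = 0")
        case True
        then have w: "w = (c, j, b)" "a \<noteq> 0" "j \<noteq> 0" using xy(3) by (simp_all add: w_def eq pole_adj_def)
        show ?thesis
          unfolding w(1) zeq merged_adj_def pole_adj_def split_conv using w(2,3) True kx ky by auto
      next
        case False
        then have w: "w = (d, i, a)" "j = 0" "b \<noteq> 0" using xy(3) by (simp_all add: w_def eq pole_adj_def)
        show ?thesis
          unfolding w(1) zeq merged_adj_def pole_adj_def split_conv using w(2,3) False kx ky by auto
      qed
    qed
    ultimately show "\<exists>w\<in>wedge_verts r q. w \<noteq> x \<and> w \<noteq> y \<and> \<not> merged_adj w w \<and> \<not> pole_adj w w \<and>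
      (\<forall>z\<in>wedge_verts r q. \<not> merged_adj x z \<and> \<not> merged_adj z x \<and> \<not> merged_adj y z \<and> \<not> merged_adj z y \<longrightarrow>
        \<not> merged_adj w z \<and> \<not> merged_adj z w \<and> \<not> pole_adj w z \<and> \<not> pole_adj z w)"
      by blast
  qed
  let ?E = "\<lambda>x y. merged_adj x y \<or> pole_adj x y"
  show "same_simple_homotopy_type (ind (wedge_verts r q) ?E)
    (ind (wedge_verts r q) (\<lambda>x y. ?E x y \<or> equator_adj x y))"
  proof (rule ind_add_edges[OF finite_wedge_verts])
    fix x y assume xy: "x \<in> wedge_verts r q" "y \<in> wedge_verts r q" "equator_adj x y"
    obtain c i a d j b where eq: "x = (c, i, a)" "y = (d, j, b)" by (cases x, cases y)
    \<comment> \<open>Each antipode is now separated from the equators of the other copies, so a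
      face meeting two equators contains no antipode and the base point can be added.\<close>
    let ?w = "(0::nat, 0::nat, 0::nat)"
    have "?w \<in> wedge_verts r q" "?w \<noteq> x" "?w \<noteq> y" "\<not> ?E ?w ?w" "\<not> equator_adj ?w ?w"
      using xy assms unfolding eq
      by (auto simp: wedge_verts_def pole_adj_def merged_adj_def equator_adj_def)
    moreover have "\<not> ?E ?w z \<and> \<not> ?E z ?w \<and> \<not> equator_adj ?w z \<and> \<not> equator_adj z ?w"
      if z: "z \<in> wedge_verts r q" "\<not> ?E x z \<and> \<not> ?E z x \<and> \<not> ?E y z \<and> \<not> ?E z y" for z
    proof -
      obtain e k f where zeq: "z = (e, k, f)" by (cases z)
      have cd: "c \<noteq> d" "i \<noteq> 0" "j \<noteq> 0" using xy(3) unfolding eq equator_adj_def by simp_all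
      have "\<not> pole_adj x z" "\<not> pole_adj y z" using z(2) by simp_all
      then have "k = 0 \<longrightarrow> f = 0"
        unfolding eq zeq pole_adj_def split_conv using cd by metis
      then show ?thesis
        unfolding zeq merged_adj_def pole_adj_def equator_adj_def split_conv by auto
    qed
    ultimately show "\<exists>w\<in>wedge_verts r q. w \<noteq> x \<and> w \<noteq> y \<and> \<not> ?E w w \<and> \<not> equator_adj w w \<and>
      (\<forall>z\<in>wedge_verts r q. \<not> ?E x z \<and> \<not> ?E z x \<and> \<not> ?E y z \<and> \<not> ?E z y \<longrightarrow>
        \<not> ?E w z \<and> \<not> ?E z w \<and> \<not> equator_adj w z \<and> \<not> equator_adj z w)"
      by blast
  qed
qed

text \<open>For \<open>merged_adj\<close>, an equator vertex of copy \<open>c\<close> is a twin of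
  the one in copy \<open>0\<close>, so the loops in \<open>?B\<close> delete all equators but one.
  The base point and the \<open>r\<close> antipodes are pairwise incompatible and give the
  \<open>r + 1\<close> points; the equator gives the \<open>s\<close> pairs.\<close>

lemma merged_to_suspended_points:
  assumes "0 < r"
  shows "same_simple_homotopy_type (ind (wedge_verts r (Suc s)) merged_adj) (suspended_points (r + 1) s)"
proof -
  let ?V = "wedge_verts r (Suc s)"
  let ?D = "\<lambda>(c, i, a). c \<noteq> 0 \<and> i \<noteq> (0::nat)"
  let ?B = "\<lambda>x y. x = y \<and> ?D x"
  let ?W = "{x \<in> ?V. \<not> ?D x}"
  have "same_simple_homotopy_type (ind ?V merged_adj) (ind ?V (\<lambda>x y. merged_adj x y \<or> ?B x y))"
  proof (rule ind_add_edges[OF finite_wedge_verts])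
    fix x y assume xy: "x \<in> ?V" "y \<in> ?V" "?B x y"
    obtain c i a where eq: "x = (c, i, a)" by (cases x)
    let ?w = "(0::nat, i, a)"
    have "?w \<in> ?V" "?w \<noteq> x" "?w \<noteq> y" "\<not> merged_adj ?w ?w" "\<not> ?B ?w ?w"
      using xy assms unfolding eq by (auto simp: wedge_verts_def merged_adj_def)
    moreover have "\<not> merged_adj ?w z \<and> \<not> merged_adj z ?w \<and> \<not> ?B ?w z \<and> \<not> ?B z ?w"
      if z: "z \<in> ?V" "\<not> merged_adj x z \<and> \<not> merged_adj z x \<and> \<not> merged_adj y z \<and> \<not> merged_adj z y" for z
    proof -
      obtain e k f where zeq: "z = (e, k, f)" by (cases z)
      have "i \<noteq> 0" using xy(3) unfolding eq by simp
      moreover have "\<not> merged_adj x z" "\<not> merged_adj z x" using z(2) by simp_all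
      ultimately have "\<not> merged_adj ?w z" "\<not> merged_adj z ?w"
        unfolding eq zeq merged_adj_def split_conv by metis+
      moreover have "\<not> ?B ?w z" "\<not> ?B z ?w" by auto
      ultimately show ?thesis by blast
    qed
    ultimately show "\<exists>w\<in>?V. w \<noteq> x \<and> w \<noteq> y \<and> \<not> merged_adj w w \<and> \<not> ?B w w \<and>
      (\<forall>z\<in>?V. \<not> merged_adj x z \<and> \<not> merged_adj z x \<and> \<not> merged_adj y z \<and> \<not> merged_adj z y \<longrightarrow>
        \<not> merged_adj w z \<and> \<not> merged_adj z w \<and> \<not> ?B w z \<and> \<not> ?B z w)"
      by blast
  qed
  also have "ind ?V (\<lambda>x y. merged_adj x y \<or> ?B x y) = ind ?W merged_adj"
    unfolding ind_def by auto
  finally have 1: "same_simple_homotopy_type (ind ?V merged_adj) (ind ?W merged_adj)" .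
  let ?\<pi> = "\<lambda>(c, i, a). if i = 0 then (1::nat, if a = 0 then 0 else c + 1) else (0, 2 * (i - 1) + a)"
  let ?\<psi> = "\<lambda>(i::nat, k::nat). if i = 0 then (0, k div 2 + 1, k mod 2) else if k = 0 then (0, 0, 0) else (k - 1, 0, 1)"
  have "same_simple_homotopy_type (suspended_points (r + 1) s) (ind ?W merged_adj)"
    unfolding padded_def
  proof (rule ind_iso)
    show "bij_betw ?\<pi> ?W ({0} \<times> {..<2 * s} \<union> {1} \<times> {..<r + 1})"
    proof (rule bij_betw_byWitness[where f' = ?\<psi>])
      show "\<forall>x\<in>?W. ?\<psi> (?\<pi> x) = x" by (auto simp: wedge_verts_def)
      show "\<forall>x\<in>{0} \<times> {..<2 * s} \<union> {1} \<times> {..<r + 1}. ?\<pi> (?\<psi> x) = x" by auto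
      show "?\<pi> ` ?W \<subseteq> {0} \<times> {..<2 * s} \<union> {1} \<times> {..<r + 1}" using assms by (auto simp: wedge_verts_def split: if_splits)
      show "?\<psi> ` ({0} \<times> {..<2 * s} \<union> {1} \<times> {..<r + 1}) \<subseteq> ?W" using assms by (auto simp: wedge_verts_def split: if_splits)
    qed
    show "finite ?W" using finite_wedge_verts by simp
    show "merged_adj x y \<longleftrightarrow> pad_adj (?\<pi> x) (?\<pi> y) \<or> clique_adj (?\<pi> x) (?\<pi> y)"
      if "x \<in> ?W" "y \<in> ?W" for x y
    proof -
      obtain c i a d j b where eq: "x = (c, i, a)" "y = (d, j, b)" by (cases x, cases y)
      have "a < 2" "b < 2" "(i = 0 \<and> a = 0) \<longrightarrow> c = 0" "(j = 0 \<and> b = 0) \<longrightarrow> d = 0"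
        using that eq by (auto simp: wedge_verts_def)
      then show ?thesis unfolding eq merged_adj_def pad_adj_def clique_adj_def split_conv
        by (cases i; cases j) (auto split: if_splits)
    qed
  qed
  then show ?thesis using same_simple_homotopy_type_trans[OF 1 same_simple_homotopy_type_sym] by blast
qed

lemma finite_complex_disjoint_copies:
  assumes "finite_complex K" and "0 < r"
  shows "finite_complex (disjoint_copies r K)"
proof -
  have K: "finite K" "\<forall>\<sigma>\<in>K. finite \<sigma>" "{} \<in> K" "\<forall>\<sigma>\<in>K. \<forall>\<rho>. \<rho> \<subseteq> \<sigma> \<longrightarrow> \<rho> \<in> K"
    using assms(1) unfolding finite_complex_def by blast+
  have mem: "\<tau> \<in> disjoint_copies r K \<longleftrightarrow> (\<exists>c<r. \<exists>\<sigma>\<in>K. \<tau> = Pair c ` \<sigma>)" for \<tau>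
    unfolding disjoint_copies_def by blast
  have "disjoint_copies r K = (\<Union>c<r. (`) (Pair c) ` K)"
    unfolding disjoint_copies_def by blast
  then have "finite (disjoint_copies r K)" using K(1) by simp
  moreover have "{} \<in> disjoint_copies r K"
    unfolding mem using \<open>0 < r\<close> K(3) by (intro exI[of _ 0] conjI bexI[of _ "{}"]) simp_all
  moreover have "\<forall>\<tau>\<in>disjoint_copies r K. finite \<tau>" using K(2) by (auto simp: mem)
  moreover have "\<rho> \<in> disjoint_copies r K" if \<tau>: "\<tau> \<in> disjoint_copies r K" "\<rho> \<subseteq> \<tau>" for \<tau> \<rho>
  proof -
    obtain c \<sigma> where c: "c < r" "\<sigma> \<in> K" "\<tau> = Pair c ` \<sigma>" using \<tau>(1) unfolding mem by blast
    obtain \<sigma>' where "\<sigma>' \<subseteq> \<sigma>" "\<rho> = Pair c ` \<sigma>'" using \<tau>(2) unfolding c(3) by (rule subset_imageE)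
    then show ?thesis unfolding mem using K(4) c(1,2) by blast
  qed
  ultimately show ?thesis unfolding finite_complex_def by simp
qed

text \<open>The dimensions agree because \<open>diamond (int s)\<close> has \<open>Suc s\<close>
  antipodal pairs: pair \<open>0\<close> provides the base point and its antipode, the other
  \<open>s\<close> pairs the equator.\<close>

lemma suspended_points_wedge:
  assumes "0 < r" and b: "\<forall>c<r. b c \<in> \<Union>(diamond (int s))"
  shows "same_simple_homotopy_type (suspended_points (r + 1) s) (wedge r b (diamond (int s)))"
proof -
  have d: "diamond (int s) = ind (cross_verts (Suc s)) cross_adj" by (rule diamond_eq_ind) simp
  let ?W = "wedge r b (diamond (int s))" and ?W' = "wedge r (\<lambda>_. (0, 0)) (diamond (int s))"
  have b': "b c \<in> cross_verts (Suc s)" if "c < r" for c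
    using b[rule_format, OF that] unfolding d Union_cross .
  have W': "?W' = ind (wedge_verts r (Suc s)) (\<lambda>x y. (merged_adj x y \<or> pole_adj x y) \<or> equator_adj x y)"
    unfolding d using wedge_base_eq_ind[OF \<open>0 < r\<close>] by simp
  have sht: "same_simple_homotopy_type (suspended_points (r + 1) s) ?W'"
    using same_simple_homotopy_type_trans[OF same_simple_homotopy_type_sym[OF
        merged_to_suspended_points[OF \<open>0 < r\<close>, of s]] merged_to_wedge[OF \<open>0 < r\<close>, of "Suc s"]]
    unfolding W' by simp
  have iso: "simplicial_iso ?W ?W'"
    unfolding d by (rule wedge_diamond_base[OF \<open>0 < r\<close> b'])
  have fW': "finite_complex ?W'" unfolding W' by (rule finite_complex_ind[OF finite_wedge_verts])
  have fW: "finite_complex ?W"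
  proof -
    have "finite_complex (disjoint_copies r (diamond (int s)))"
      unfolding d by (rule finite_complex_disjoint_copies[OF finite_complex_ind \<open>0 < r\<close>]) simp
    then show ?thesis unfolding wedge_def by (rule finite_complex_image)
  qed
  show ?thesis
    by (rule same_simple_homotopy_type_trans[OF sht same_simple_homotopy_type_sym[OF
            simplicial_iso_imp_same_simple_homotopy_type[OF fW fW' iso]]])
qed

section \<open>Homotopy types of the cylindrical grids\<close>

lemma shorten_cyl_2_iter:
  assumes "n \<ge> 2"
  shows "same_simple_homotopy_type (cyl 2 (4 * k + n) s) (cyl 2 n (s + 2 * k))"
proof (induction k arbitrary: s)
  case 0
  show ?case using same_simple_homotopy_type_refl[OF finite_complex_padded] by simp
next
  case (Suc k)
  have "same_simple_homotopy_type (cyl 2 (4 * k + n + 4) s) (cyl 2 (4 * k + n) (s + 2))"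
    using assms by (intro shorten_cyl_2) simp
  from same_simple_homotopy_type_trans[OF this Suc.IH] show ?case by (simp add: algebra_simps)
qed

lemma shorten_cyl_3_iter:
  assumes "n \<ge> 2"
  shows "same_simple_homotopy_type (cyl 3 (8 * k + n) s) (cyl 3 n (s + 6 * k))"
proof (induction k arbitrary: s)
  case 0
  show ?case using same_simple_homotopy_type_refl[OF finite_complex_padded] by simp
next
  case (Suc k)
  have "same_simple_homotopy_type (cyl 3 (8 * k + n + 8) s) (cyl 3 (8 * k + n) (s + 6))"
    using assms by (intro shorten_cyl_3) simp
  from same_simple_homotopy_type_trans[OF this Suc.IH] show ?case by (simp add: algebra_simps)
qed

lemma indep_complex_cyl:
  assumes "n \<ge> 1"
  shows "indep_complex (cyl_graph m n) = cyl m n 0"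
proof -
  have "{0} \<times> {..<2 * 0} \<union> {1..m} \<times> {1..n} = {1..m} \<times> {1..n}" by simp
  then show ?thesis
    unfolding indep_complex_cyl_graph[OF assms] padded_def
    by (simp only:) (rule ind_cong, auto simp: pad_adj_def)
qed

lemma cyl_2_type:
  assumes "n \<ge> 2" and "\<And>s. same_simple_homotopy_type (cyl 2 n s) (suspended_points q (s + t))"
  shows "same_simple_homotopy_type (indep_complex (cyl_graph 2 (4 * k + n))) (suspended_points q (2 * k + t))"
  using same_simple_homotopy_type_trans[OF shorten_cyl_2_iter[OF assms(1), where k = k and s = 0] assms(2)] assms(1)
  by (simp add: indep_complex_cyl)

lemma cyl_3_type:
  assumes "n \<ge> 2" and "\<And>s. same_simple_homotopy_type (cyl 3 n s) (suspended_points q (s + t))"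
  shows "same_simple_homotopy_type (indep_complex (cyl_graph 3 (8 * k + n))) (suspended_points q (6 * k + t))"
  using same_simple_homotopy_type_trans[OF shorten_cyl_3_iter[OF assms(1), where k = k and s = 0] assms(2)] assms(1)
  by (simp add: indep_complex_cyl)

lemma suspended_points_0_diamond:
  assumes "same_simple_homotopy_type K (suspended_points 0 s)" "d = int s - 1"
  shows "same_simple_homotopy_type K (diamond d)"
  using same_simple_homotopy_type_trans[OF assms(1) suspended_points_0] assms(2) by simp

lemma suspended_points_diamond_wedge:
  assumes "same_simple_homotopy_type K (suspended_points (r + 1) s)" "d = int s"
    and "\<forall>c<r. b c \<in> \<Union>(diamond d)" "0 < r"
  shows "same_simple_homotopy_type K (wedge r b (diamond d))"
  using same_simple_homotopy_type_trans[OF assms(1) suspended_points_wedge] assms(2-4) by simp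

text \<open>With one column every vertex carries a loop, so only the empty simplex remains.\<close>

lemma indep_complex_cyl_graph_1:
  "same_simple_homotopy_type (indep_complex (cyl_graph m 1)) (diamond (- 1))"
proof -
  have "indep_complex (cyl_graph m 1) = {{}}"
  proof -
    have "cyl_adj 1 x x" if "x \<in> {1..m} \<times> {1..1}" for x using that unfolding cyl_adj_def by auto
    then have "S = {}" if "S \<in> ind ({1..m} \<times> {1..1}) (cyl_adj 1)" for S
      using that unfolding ind_iff by blast
    moreover have "{} \<in> ind ({1..m} \<times> {1..1}) (cyl_adj 1)" by (simp add: ind_iff)
    ultimately have "ind ({1..m} \<times> {1..1}) (cyl_adj 1) = {{}}" by blast
    then show ?thesis by (simp add: indep_complex_cyl_graph)
  qed
  moreover have "diamond (- 1) = {{}}"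
  proof -
    have "diamond (- 1) = ind (cross_verts 0) cross_adj" by (rule diamond_eq_ind) simp
    then show ?thesis by (auto simp: ind_def)
  qed
  moreover have "finite_complex {{} :: (nat \<times> nat) set}" unfolding finite_complex_def by auto
  ultimately show ?thesis using same_simple_homotopy_type_refl by metis
qed

lemma cyl_2_cases:
  fixes k i :: nat
  assumes "i \<in> {0, 1, 2, 3}" "4 * k + i \<ge> 1"
  shows "i = 0 \<Longrightarrow> \<forall>c<3. b c \<in> \<Union>(diamond (2 * int k - 1)) \<Longrightarrow>
      same_simple_homotopy_type (indep_complex (cyl_graph 2 (4 * k + i))) (wedge 3 b (diamond (2 * int k - 1)))"
    and "i = 1 \<Longrightarrow> same_simple_homotopy_type (indep_complex (cyl_graph 2 (4 * k + i))) (diamond (2 * int k - 1))"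
    and "i = 2 \<Longrightarrow> same_simple_homotopy_type (indep_complex (cyl_graph 2 (4 * k + i))) (diamond (2 * int k))"
    and "i = 3 \<Longrightarrow> same_simple_homotopy_type (indep_complex (cyl_graph 2 (4 * k + i))) (diamond (2 * int k + 1))"
proof -
  show "same_simple_homotopy_type (indep_complex (cyl_graph 2 (4 * k + i))) (wedge 3 b (diamond (2 * int k - 1)))"
    if i0: "i = 0" and "\<forall>c<3. b c \<in> \<Union>(diamond (2 * int k - 1))"
  proof -
    \<comment> \<open>There is no cylinder without columns, so residue 0 starts from four columns
      and is shortened \<open>k - 1\<close> times.\<close>
    obtain l where "k = Suc l" using assms(2) i0 by (cases k) auto
    then show ?thesis
      using cyl_2_type[OF _ reduce_cyl_2_4, of l] that
      by (intro suspended_points_diamond_wedge[where s = "2 * l + 1"]) (simp_all add: add.commute)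
  qed
  show "same_simple_homotopy_type (indep_complex (cyl_graph 2 (4 * k + i))) (diamond (2 * int k - 1))" if "i = 1"
  proof (cases k)
    case 0
    then show ?thesis using indep_complex_cyl_graph_1 that by simp
  next
    case (Suc l)
    then show ?thesis
      using cyl_2_type[OF _ reduce_cyl_2_5, of l] that
      by (intro suspended_points_0_diamond[where s = "2 * l + 2"]) (simp_all add: add.commute)
  qed
  show "same_simple_homotopy_type (indep_complex (cyl_graph 2 (4 * k + i))) (diamond (2 * int k))" if "i = 2"
    using cyl_2_type[OF _ reduce_cyl_2_2, of k] that
    by (intro suspended_points_0_diamond[where s = "2 * k + 1"]) simp_all
  show "same_simple_homotopy_type (indep_complex (cyl_graph 2 (4 * k + i))) (diamond (2 * int k + 1))" if "i = 3"
    using cyl_2_type[OF _ reduce_cyl_2_3, of k] that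
    by (intro suspended_points_0_diamond[where s = "2 * k + 2"]) simp_all
qed

lemma cyl_3_diamond:
  assumes "n \<ge> 2" "\<And>s. same_simple_homotopy_type (cyl 3 n s) (suspended_points 0 (s + t))"
    and "N = 8 * k + n" "d = 6 * int k + int t - 1"
  shows "same_simple_homotopy_type (indep_complex (cyl_graph 3 N)) (diamond d)"
  unfolding assms(3)
  by (rule suspended_points_0_diamond[OF cyl_3_type[OF assms(1,2)]]) (simp add: assms(4))

lemma cyl_3_wedge:
  assumes "n \<ge> 2" "\<And>s. same_simple_homotopy_type (cyl 3 n s) (suspended_points q (s + t))" "q = r + 1"
    and "N = 8 * k + n" "d = 6 * int k + int t" "\<forall>c<r. b c \<in> \<Union>(diamond d)" "0 < r"
  shows "same_simple_homotopy_type (indep_complex (cyl_graph 3 N)) (wedge r b (diamond d))"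
  unfolding assms(4)
  by (rule suspended_points_diamond_wedge[OF cyl_3_type[OF assms(1,2)[unfolded assms(3)]] _ assms(6,7)])
    (simp add: assms(5))

lemma cyl_3_cases:
  fixes k i :: nat
  assumes "i \<in> {0, 1, 2, 3, 4, 5, 6, 7}" "8 * k + i \<ge> 1"
  defines "N \<equiv> 8 * k + i"
  shows "i = 0 \<Longrightarrow> \<forall>c<5. b c \<in> \<Union>(diamond (6 * int k - 1)) \<Longrightarrow>
      same_simple_homotopy_type (indep_complex (cyl_graph 3 N)) (wedge 5 b (diamond (6 * int k - 1)))"
    and "i = 1 \<Longrightarrow> same_simple_homotopy_type (indep_complex (cyl_graph 3 N)) (diamond (6 * int k - 1))"
    and "i \<in> {2, 3} \<Longrightarrow> same_simple_homotopy_type (indep_complex (cyl_graph 3 N)) (diamond (6 * int k + 1))"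
    and "i = 4 \<Longrightarrow> \<forall>c<3. b c \<in> \<Union>(diamond (6 * int k + 2)) \<Longrightarrow>
      same_simple_homotopy_type (indep_complex (cyl_graph 3 N)) (wedge 3 b (diamond (6 * int k + 2)))"
    and "i \<in> {5, 6} \<Longrightarrow> same_simple_homotopy_type (indep_complex (cyl_graph 3 N)) (diamond (6 * int k + 3))"
    and "i = 7 \<Longrightarrow> same_simple_homotopy_type (indep_complex (cyl_graph 3 N)) (diamond (6 * int k + 5))"
proof -
  show "same_simple_homotopy_type (indep_complex (cyl_graph 3 N)) (wedge 5 b (diamond (6 * int k - 1)))"
    if i0: "i = 0" and "\<forall>c<5. b c \<in> \<Union>(diamond (6 * int k - 1))"
  proof -
    \<comment> \<open>The base cylinder has eight columns and leaves five isolated edges; the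
      dimension \<open>6 * l + 5\<close> is \<open>6 * k - 1\<close>.\<close>
    obtain l where "k = Suc l" using assms(2) i0 by (cases k) auto
    then show ?thesis using that unfolding N_def
      by (intro cyl_3_wedge[OF _ reduce_cyl_3_8, where k = l]) simp_all
  qed
  show "same_simple_homotopy_type (indep_complex (cyl_graph 3 N)) (diamond (6 * int k - 1))" if "i = 1"
  proof (cases k)
    case 0
    then show ?thesis using indep_complex_cyl_graph_1 that unfolding N_def by simp
  next
    case (Suc l)
    then show ?thesis using that unfolding N_def
      by (intro cyl_3_diamond[OF _ reduce_cyl_3_9, where k = l]) simp_all
  qed
  show "same_simple_homotopy_type (indep_complex (cyl_graph 3 N)) (diamond (6 * int k + 1))" if "i \<in> {2, 3}"
  proof (cases "i = 2")
    case True
    then show ?thesis unfolding N_def by (intro cyl_3_diamond[OF _ reduce_cyl_3_2, where k = k]) simp_all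
  next
    case False
    then show ?thesis using that unfolding N_def
      by (intro cyl_3_diamond[OF _ reduce_cyl_3_3, where k = k]) simp_all
  qed
  show "same_simple_homotopy_type (indep_complex (cyl_graph 3 N)) (wedge 3 b (diamond (6 * int k + 2)))"
    if "i = 4" "\<forall>c<3. b c \<in> \<Union>(diamond (6 * int k + 2))"
    using that unfolding N_def by (intro cyl_3_wedge[OF _ reduce_cyl_3_4, where k = k]) simp_all
  show "same_simple_homotopy_type (indep_complex (cyl_graph 3 N)) (diamond (6 * int k + 3))" if "i \<in> {5, 6}"
  proof (cases "i = 5")
    case True
    then show ?thesis unfolding N_def by (intro cyl_3_diamond[OF _ reduce_cyl_3_5, where k = k]) simp_all
  next
    case False
    then show ?thesis using that unfolding N_def
      by (intro cyl_3_diamond[OF _ reduce_cyl_3_6, where k = k]) simp_all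
  qed
  show "same_simple_homotopy_type (indep_complex (cyl_graph 3 N)) (diamond (6 * int k + 5))" if "i = 7"
    using that unfolding N_def by (intro cyl_3_diamond[OF _ reduce_cyl_3_7, where k = k]) simp_all
qed

theorem corollary1p5:
  "(\<forall>k i :: nat. i \<in> {0, 1, 2, 3} \<and> 4 * k + i \<ge> 1 \<longrightarrow>
      (i = 0 \<longrightarrow> (\<forall>b. (\<forall>c<3. b c \<in> \<Union>(diamond (2 * int k - 1))) \<longrightarrow>
         same_simple_homotopy_type (indep_complex (cyl_graph 2 (4 * k + i)))
           (wedge 3 b (diamond (2 * int k - 1))))) \<and>
      (i = 1 \<longrightarrow> same_simple_homotopy_type (indep_complex (cyl_graph 2 (4 * k + i)))
         (diamond (2 * int k - 1))) \<and>
      (i = 2 \<longrightarrow> same_simple_homotopy_type (indep_complex (cyl_graph 2 (4 * k + i)))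
         (diamond (2 * int k))) \<and>
      (i = 3 \<longrightarrow> same_simple_homotopy_type (indep_complex (cyl_graph 2 (4 * k + i)))
         (diamond (2 * int k + 1)))) \<and>
   (\<forall>k i :: nat. i \<in> {0, 1, 2, 3, 4, 5, 6, 7} \<and> 8 * k + i \<ge> 1 \<longrightarrow>
      (i = 0 \<longrightarrow> (\<forall>b. (\<forall>c<5. b c \<in> \<Union>(diamond (6 * int k - 1))) \<longrightarrow>
         same_simple_homotopy_type (indep_complex (cyl_graph 3 (8 * k + i)))
           (wedge 5 b (diamond (6 * int k - 1))))) \<and>
      (i = 1 \<longrightarrow> same_simple_homotopy_type (indep_complex (cyl_graph 3 (8 * k + i)))
         (diamond (6 * int k - 1))) \<and>
      (i \<in> {2, 3} \<longrightarrow> same_simple_homotopy_type (indep_complex (cyl_graph 3 (8 * k + i)))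
         (diamond (6 * int k + 1))) \<and>
      (i = 4 \<longrightarrow> (\<forall>b. (\<forall>c<3. b c \<in> \<Union>(diamond (6 * int k + 2))) \<longrightarrow>
         same_simple_homotopy_type (indep_complex (cyl_graph 3 (8 * k + i)))
           (wedge 3 b (diamond (6 * int k + 2))))) \<and>
      (i \<in> {5, 6} \<longrightarrow> same_simple_homotopy_type (indep_complex (cyl_graph 3 (8 * k + i)))
         (diamond (6 * int k + 3))) \<and>
      (i = 7 \<longrightarrow> same_simple_homotopy_type (indep_complex (cyl_graph 3 (8 * k + i)))
         (diamond (6 * int k + 5))))"
  by (intro conjI allI impI; elim conjE; (rule cyl_2_cases cyl_3_cases; assumption))

end
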